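(* Let $N$ be a positive integer and let $d,k$ be integers with $1\le k\le d$. Suppose that $\vec{c}_1=[c_{1,0},\dots,c_{1,d}],\dots,\vec{c}_k=[c_{k,0},\dots,c_{k,d}]$ are linearly independent geometric progressions modulo $N$, all with the same ratio $m$ modulo $N$, such that $\gcd(c_{1,0},N)=1$. Let $L\subseteq\mathbb{Z}^{d+1}$ be the lattice with basis $(\vec{c}_1,\dots,\vec{c}_k)$ and $S=\mathrm{diag}(1,s,\dots,s^d)$ for a real number $s>0$. Then the lattice $L^\perp_S$ is $(d-k+1)$-dimensional and $$\det L^\perp_S\le s^{\frac{d(d-k+1)}{2}}\cdot N^{1-k}\cdot\prod_{i=1}^{k}\|\vec{c}_i\|_{2,s^{-1}}.$$
   Context: A geometric progression (GP) of length $\ell$ and ratio $r$ modulo $N$, where $r\in\mathbb{Z}/N\mathbb{Z}$, is an integer vector $[c_0,\dots,c_{\ell-1}]$ with $c_i\equiv c_0 r^i\pmod N$ for $0\le i<\ell$. For $\vec{x}=(x_0,\dots,x_d)\in\mathbb{R}^{d+1}$ and real $t>0$, $\|\vec{x}\|_{2,t}=t^{-d/2}\left(\sum_{i=0}^{d}(x_i t^i)^2\right)^{1/2}$; thus $\|\vec{x}\|_{2,s^{-1}}=s^{d/2}\left(\sum_{i=0}^d x_i^2 s^{-2i}\right)^{1/2}$. For a lattice $\Lambda\subseteq\mathbb{Z}^n$, $E_\Lambda$ is its $\mathbb{Q}$-span in $\mathbb{Q}^n$ and $\Lambda^\perp=\mathbb{Z}^n\cap E_\Lambda^\perp$ (standard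 inner product). For $T\in\mathrm{GL}_n(\mathbb{R})$, $\Gamma_T=\{\vec{x}T:\vec{x}\in\Gamma\}$ (row vectors) and $L^\perp_S=(L^\perp)_S$. The determinant of a lattice with basis matrix $C$ is $\sqrt{\det(CC^t)}$. *)

theory Defs
  imports
    Complex_Main
    "HOL-Number_Theory.Cong"
    "Jordan_Normal_Form.DL_Rank"
begin

definition geometric_progression :: "nat \<Rightarrow> int \<Rightarrow> nat \<Rightarrow> int vec \<Rightarrow> bool" where
  "geometric_progression N r l c \<longleftrightarrow>
     c \<in> carrier_vec l \<and> (\<forall>i<l. [c $ i = c $ 0 * r ^ i] (mod int N))"

text \<open>The degree \<open>d\<close> in the norm is \<open>dim_vec x - 1\<close>.\<close>

definition norm2 :: "real \<Rightarrow> real vec \<Rightarrow> real" where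
  "norm2 t x = t powr (- (real (dim_vec x) - 1) / 2) * sqrt (\<Sum>i<dim_vec x. (x $ i * t ^ i)\<^sup>2)"

text \<open>The coefficient ring is the type of the entries; for integer vectors, linear independence
  over the integers is the same as over the rationals or the reals.\<close>

definition lin_indpt_list :: "nat \<Rightarrow> 'a :: comm_ring_1 vec list \<Rightarrow> bool" where
  "lin_indpt_list n bs \<longleftrightarrow> set bs \<subseteq> carrier_vec n \<and> distinct bs \<and>
     LinearCombinations.module.lin_indpt class_ring (module_vec TYPE('a) n) (set bs)"

definition lattice_basis :: "nat \<Rightarrow> 'a :: comm_ring_1 vec list \<Rightarrow> 'a vec set \<Rightarrow> bool" where
  "lattice_basis n bs \<Lambda> \<longleftrightarrow> lin_indpt_list n bs \<and> \<Lambda> = vec_module.lattice_of n bs"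

definition lattice_of_dim :: "nat \<Rightarrow> nat \<Rightarrow> real vec set \<Rightarrow> bool" where
  "lattice_of_dim n r \<Lambda> \<longleftrightarrow> (\<exists>bs. lattice_basis n bs \<Lambda> \<and> length bs = r)"

definition lattice_det :: "nat \<Rightarrow> real vec set \<Rightarrow> real" where
  "lattice_det n \<Lambda> = (THE D. \<exists>bs. lattice_basis n bs \<Lambda> \<and>
     D = sqrt (det (mat_of_rows n bs * transpose_mat (mat_of_rows n bs))))"

definition rat_span :: "nat \<Rightarrow> int vec set \<Rightarrow> rat vec set" where
  "rat_span n \<Lambda> =
     LinearCombinations.module.span class_ring (module_vec TYPE(rat) n) (map_vec rat_of_int ` \<Lambda>)"

definition lattice_perp :: "nat \<Rightarrow> int vec set \<Rightarrow> int vec set" where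
  "lattice_perp n \<Lambda> =
     {x \<in> carrier_vec n. map_vec rat_of_int x \<in> vec_module.orthogonal_complement n (rat_span n \<Lambda>)}"

text \<open>The row vector \<open>x T\<close> is the column vector \<open>T\<^sup>T x\<close>.\<close>

definition lattice_transform :: "real mat \<Rightarrow> int vec set \<Rightarrow> real vec set" where
  "lattice_transform T \<Gamma> = (\<lambda>x. transpose_mat T *\<^sub>v map_vec real_of_int x) ` \<Gamma>"


text \<open>Dimension and determinant do not depend on the basis.\<close>

lemma lin_indpt_list_left_cancel:
  fixes bs :: "'a :: field vec list"
  assumes li: "lin_indpt_list n bs" and A: "A \<in> carrier_mat r (length bs)"
    and eq: "A * mat_of_rows n bs = mat_of_rows n bs" and r: "r = length bs"
  shows "A = 1\<^sub>m r"
proof -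
  let ?B = "mat_of_rows n bs"
  interpret vec_space "TYPE('a)" n .
  have bs: "set bs \<subseteq> carrier_vec n" "distinct bs" "lin_indpt (set bs)"
    using li unfolding lin_indpt_list_def by auto
  have cols: "cols (transpose_mat ?B) = bs" using bs(1) by simp
  have kernel: "v = 0\<^sub>v r" if v: "v \<in> carrier_vec r" "transpose_mat ?B *\<^sub>v v = 0\<^sub>v n" for v
  proof (rule ccontr)
    assume "v \<noteq> 0\<^sub>v r"
    with v r have "lin_dep (set (cols (transpose_mat ?B)))"
      by (intro lin_depI[of "transpose_mat ?B" r v]) (auto simp: cols bs(1,2))
    with bs(3) cols show False by simp
  qed
  define E where "E = A - 1\<^sub>m r"
  have E: "E \<in> carrier_mat r r" and B: "?B \<in> carrier_mat r n"
    using A r by (auto simp: E_def)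
  have "E * ?B = A * ?B - 1\<^sub>m r * ?B"
    unfolding E_def using A B r by (intro minus_mult_distrib_mat[of _ r r]) auto
  also have "\<dots> = 0\<^sub>m r n" using eq B by auto
  finally have EB: "E * ?B = 0\<^sub>m r n" .
  have "E = 0\<^sub>m r r"
  proof (rule eq_rowI)
    fix i assume "i < dim_row (0\<^sub>m r r :: 'a mat)"
    then have i: "i < r" by simp
    have "transpose_mat ?B *\<^sub>v row E i = 0\<^sub>v n"
    proof (rule eq_vecI)
      fix j assume "j < dim_vec (0\<^sub>v n :: 'a vec)"
      then have j: "j < n" by simp
      have "(transpose_mat ?B *\<^sub>v row E i) $ j = col ?B j \<bullet> row E i" using j B by simp
      also have "\<dots> = row E i \<bullet> col ?B j"
        by (rule comm_scalar_prod[of _ r]) (use E B i j in auto)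
      also have "\<dots> = (E * ?B) $$ (i, j)" using E B i j by simp
      finally show "(transpose_mat ?B *\<^sub>v row E i) $ j = (0\<^sub>v n :: 'a vec) $ j"
        using EB i j by simp
    qed (use B in auto)
    then have "row E i = 0\<^sub>v r" using kernel[of "row E i"] E i by auto
    then show "row E i = row (0\<^sub>m r r) i" using i by simp
  qed (use E in auto)
  then show ?thesis
    using A r unfolding E_def
    by (intro eq_matI) (auto simp: mat_eq_iff)
qed

lemma lattice_basis_change:
  fixes bs cs :: "real vec list"
  assumes bs: "lattice_basis n bs \<Lambda>" and cs: "lattice_basis n cs \<Lambda>"
  obtains U :: "int mat" where "U \<in> carrier_mat (length bs) (length cs)"
    "mat_of_rows n bs = map_mat of_int U * mat_of_rows n cs"
proof -
  interpret vec_space "TYPE(real)" n .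
  have b: "set bs \<subseteq> carrier_vec n" "\<Lambda> = lattice_of bs"
    and c: "set cs \<subseteq> carrier_vec n" "\<Lambda> = lattice_of cs"
    using bs cs unfolding lattice_basis_def lin_indpt_list_def by auto
  have "\<exists>u. bs ! i = sumlist (map (\<lambda>j. of_int (u j) \<cdot>\<^sub>v cs ! j) [0..<length cs])"
    if "i < length bs" for i
  proof -
    have "bs ! i \<in> lattice_of bs" by (rule basis_in_latticeI) (use b that in auto)
    then have "bs ! i \<in> lattice_of cs" using b(2) c(2) by simp
    then show ?thesis by (rule in_latticeE) blast
  qed
  then obtain u where u: "\<And>i. i < length bs \<Longrightarrow>
      bs ! i = sumlist (map (\<lambda>j. of_int (u i j) \<cdot>\<^sub>v cs ! j) [0..<length cs])"
    by metis
  define U where "U = mat (length bs) (length cs) (\<lambda>(i, j). u i j)"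
  have "mat_of_rows n bs = map_mat of_int U * mat_of_rows n cs"
  proof (rule eq_matI)
    fix i j
    assume "i < dim_row (map_mat of_int U * mat_of_rows n cs)"
      "j < dim_col (map_mat of_int U * mat_of_rows n cs)"
    then have i: "i < length bs" and j: "j < n" by (auto simp: U_def)
    have "mat_of_rows n bs $$ (i, j) = bs ! i $ j" using i j by (simp add: mat_of_rows_index)
    also have "\<dots> = (\<Sum>l = 0..<length cs. of_int (u i l) * cs ! l $ j)"
    proof -
      have *: "\<And>l. l < length cs \<Longrightarrow> cs ! l \<in> carrier_vec n" using c(1) by auto
      then have "\<And>l. l < length cs \<Longrightarrow> dim_vec (cs ! l) = n" by (metis carrier_vecD)
      with sumlist_nth[of "map (\<lambda>l. of_int (u i l) \<cdot>\<^sub>v cs ! l) [0..<length cs]" j]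
      show ?thesis using u[OF i] * j by (auto intro!: sum.cong)
    qed
    also have "\<dots> = (map_mat of_int U * mat_of_rows n cs) $$ (i, j)"
      using i j by (simp add: U_def scalar_prod_def mat_of_rows_index)
    finally show "mat_of_rows n bs $$ (i, j) = (map_mat of_int U * mat_of_rows n cs) $$ (i, j)" .
  qed (auto simp: U_def)
  then show thesis by (intro that[of U]) (auto simp: U_def)
qed

lemma trace_mult_comm:
  fixes A B :: "'a :: comm_ring_1 mat"
  assumes "A \<in> carrier_mat k l" "B \<in> carrier_mat l k"
  shows "(\<Sum>i<k. (A * B) $$ (i, i)) = (\<Sum>j<l. (B * A) $$ (j, j))"
proof -
  have "(\<Sum>i<k. (A * B) $$ (i, i)) = (\<Sum>i<k. \<Sum>j<l. A $$ (i, j) * B $$ (j, i))"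
    using assms by (auto simp: scalar_prod_def atLeast0LessThan intro!: sum.cong)
  also have "\<dots> = (\<Sum>j<l. \<Sum>i<k. B $$ (j, i) * A $$ (i, j))"
    by (subst sum.swap) (simp add: mult.commute)
  also have "\<dots> = (\<Sum>j<l. (B * A) $$ (j, j))"
    using assms by (auto simp: scalar_prod_def atLeast0LessThan intro!: sum.cong)
  finally show ?thesis .
qed

lemma lattice_basis_unique:
  fixes bs cs :: "real vec list"
  assumes bs: "lattice_basis n bs \<Lambda>" and cs: "lattice_basis n cs \<Lambda>"
  shows "length bs = length cs"
    and "det (mat_of_rows n bs * transpose_mat (mat_of_rows n bs)) =
      det (mat_of_rows n cs * transpose_mat (mat_of_rows n cs))"
proof -
  let ?B = "mat_of_rows n bs" and ?C = "mat_of_rows n cs"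
  let ?k = "length bs" and ?l = "length cs"
  obtain U where U: "U \<in> carrier_mat ?k ?l" "?B = map_mat of_int U * ?C"
    using lattice_basis_change[OF bs cs] .
  obtain V where V: "V \<in> carrier_mat ?l ?k" "?C = map_mat of_int V * ?B"
    using lattice_basis_change[OF cs bs] .
  let ?U = "map_mat real_of_int U" and ?V = "map_mat real_of_int V"
  have carr: "?U \<in> carrier_mat ?k ?l" "?V \<in> carrier_mat ?l ?k" using U V by auto
  have B: "?B \<in> carrier_mat ?k n" and C: "?C \<in> carrier_mat ?l n" by auto
  have "(?U * ?V) * ?B = ?B"
    unfolding assoc_mult_mat[OF carr B] V(2)[symmetric] U(2)[symmetric] ..
  then have UV: "?U * ?V = 1\<^sub>m ?k"
    using bs carr by (intro lin_indpt_list_left_cancel[of n bs]) (auto simp: lattice_basis_def)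
  have "(?V * ?U) * ?C = ?C"
    unfolding assoc_mult_mat[OF carr(2,1) C] U(2)[symmetric] V(2)[symmetric] ..
  then have VU: "?V * ?U = 1\<^sub>m ?l"
    using cs carr by (intro lin_indpt_list_left_cancel[of n cs]) (auto simp: lattice_basis_def)
  show len: "?k = ?l"
    using trace_mult_comm[OF carr] by (simp add: UV VU)
  have "det ?U * det ?V = 1"
    using det_mult[of ?U ?k ?V] UV carr len by simp
  then have "real_of_int (det U * det V) = 1"
    by (simp add: of_int_hom.hom_det)
  then have "det U * det V = 1"
    using of_int_eq_1_iff by blast
  then have "det U = 1 \<or> det U = - 1"
    using zmult_eq_1_iff by blast
  then have sq: "det ?U * det ?U = 1" by (auto simp: of_int_hom.hom_det)
  have U': "?U \<in> carrier_mat ?k ?k" and C': "?C \<in> carrier_mat ?k n" using carr C len by auto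
  have "?B * transpose_mat ?B = (?U * ?C) * (transpose_mat ?C * transpose_mat ?U)"
    using U(2) transpose_mult[OF U' C'] by simp
  also have "\<dots> = ?U * (?C * transpose_mat ?C) * transpose_mat ?U"
  proof -
    have Ct: "transpose_mat ?C \<in> carrier_mat n ?k" and Ut: "transpose_mat ?U \<in> carrier_mat ?k ?k"
      using U' C' by auto
    have CC: "?C * transpose_mat ?C \<in> carrier_mat ?k ?k" using mult_carrier_mat[OF C' Ct] .
    show ?thesis
      unfolding assoc_mult_mat[OF U' C' mult_carrier_mat[OF Ct Ut]] assoc_mult_mat[OF U' CC Ut]
        assoc_mult_mat[OF C' Ct Ut] ..
  qed
  finally have "det (?B * transpose_mat ?B) = det ?U * det (?C * transpose_mat ?C) * det ?U"
  proof -
    have CC: "?C * transpose_mat ?C \<in> carrier_mat ?k ?k" using C' by auto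
    assume "?B * transpose_mat ?B = ?U * (?C * transpose_mat ?C) * transpose_mat ?U"
    then show ?thesis
      using det_mult[OF mult_carrier_mat[OF U' CC], of "transpose_mat ?U"] det_mult[OF U' CC]
        det_transpose[OF U'] U' by simp
  qed
  then show "det (?B * transpose_mat ?B) = det (?C * transpose_mat ?C)"
    using sq by (simp add: algebra_simps)
qed

lemma lattice_det_eq:
  assumes "lattice_basis n bs \<Lambda>"
  shows "lattice_det n \<Lambda> = sqrt (det (mat_of_rows n bs * transpose_mat (mat_of_rows n bs)))"
  unfolding lattice_det_def
  using assms by (intro the_equality) (auto dest: lattice_basis_unique(2)[OF assms])

lemma lattice_of_dim_unique:
  assumes "lattice_of_dim n r \<Lambda>" "lattice_of_dim n r' \<Lambda>"
  shows "r = r'"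
  using assms unfolding lattice_of_dim_def by (auto dest: lattice_basis_unique(1))

end

theory Submission
  imports Defs
begin

text \<open>
  An integer matrix \<open>C\<close> of rank \<open>k\<close> with rows \<open>c\<^sub>i\<close> is brought to the form \<open>[H | 0]\<close> by
  unimodular column operations: \<open>C U\<^sup>T = [H | 0]\<close> with \<open>U\<close> unimodular. The last \<open>n - k\<close> rows of
  \<open>U\<close> are then a basis of \<open>L\<^sup>\<bottom>\<close>, and \<open>\<bar>det H\<bar>\<close> is the index of \<open>L\<close> in its saturation.
  The Gram matrix of the transformed basis is a diagonal block of \<open>(U S) (U S)\<^sup>T\<close>, so Jacobi's
  identity on complementary minors of the inverse expresses its determinant through that of
  \<open>C S\<^sup>-\<^sup>2 C\<^sup>T\<close>, divided by \<open>(det H)\<^sup>2\<close>; Hadamard's inequality bounds the former. Finally, all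
  \<open>c\<^sub>i\<close> are multiples of \<open>c\<^sub>1\<close> modulo \<open>N\<close>, hence so are the rows of \<open>H\<close>, and \<open>N\<^sup>k\<^sup>-\<^sup>1\<close> divides
  the nonzero number \<open>det H\<close>.
\<close>

subsection \<open>Unimodular triangularization and determinants\<close>

lemma index_mult_mat_sum:
  assumes "A \<in> carrier_mat m n" "B \<in> carrier_mat n l" "i < m" "j < l"
  shows "(A * B) $$ (i, j) = (\<Sum>r<n. A $$ (i, r) * B $$ (r, j))"
  using assms by (simp add: scalar_prod_def atLeast0LessThan)

lemma index_mult_mat_vec_sum:
  assumes "A \<in> carrier_mat m n" "v \<in> carrier_vec n" "i < m"
  shows "(A *\<^sub>v v) $ i = (\<Sum>r<n. A $$ (i, r) * v $ r)"
  using assms by (simp add: scalar_prod_def atLeast0LessThan)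

lemma mult_mat_inverse_pairs:
  fixes A B C D :: "'a :: semiring_1 mat"
  assumes A: "A \<in> carrier_mat n n" and B: "B \<in> carrier_mat n n"
    and C: "C \<in> carrier_mat n n" and D: "D \<in> carrier_mat n n"
    and AD: "A * D = 1\<^sub>m n" and BC: "B * C = 1\<^sub>m n"
  shows "(A * B) * (C * D) = 1\<^sub>m n"
proof -
  have "(A * B) * (C * D) = A * (B * (C * D))"
    by (rule assoc_mult_mat[OF A B mult_carrier_mat[OF C D]])
  also have "B * (C * D) = D"
    unfolding assoc_mult_mat[OF B C D, symmetric] BC by (rule left_mult_one_mat[OF D])
  finally show ?thesis using AD by simp
qed

text \<open>Subtractive Euclidean algorithm: while two entries are nonzero, the one of larger
  absolute value can be reduced by the other, so the sum of absolute values serves as induction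
  measure. The inverse \<open>V\<close> is built along as an integer matrix, since it later recovers
  the original matrix from the reduced one.\<close>

lemma unimodular_zero_tail_vec:
  fixes v :: "int vec"
  assumes "v \<in> carrier_vec n"
  shows "\<exists>U V. U \<in> carrier_mat n n \<and> V \<in> carrier_mat n n \<and> U * V = 1\<^sub>m n \<and> V * U = 1\<^sub>m n \<and>
    (\<forall>i\<in>{1..<n}. (U *\<^sub>v v) $ i = 0)"
  using assms
proof (induction "\<Sum>i<n. nat \<bar>v $ i\<bar>" arbitrary: v rule: less_induct)
  case less
  note v = less.prems
  show ?case
  proof (cases "\<exists>i j. i < n \<and> j < n \<and> i \<noteq> j \<and> v $ i \<noteq> 0 \<and> \<bar>v $ i\<bar> \<le> \<bar>v $ j\<bar>")
    case True
    then obtain i j where ij: "i < n" "j < n" "i \<noteq> j" "v $ i \<noteq> 0" "\<bar>v $ i\<bar> \<le> \<bar>v $ j\<bar>" by blast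
    \<comment> \<open>With these signs, adding \<open>a\<close> times entry \<open>i\<close> to
      entry \<open>j\<close> replaces \<open>\<bar>v $ j\<bar>\<close> by
      \<open>\<bar>v $ j\<bar> - \<bar>v $ i\<bar>\<close>, a strict decrease because
      \<open>v $ i\<close> is nonzero.\<close>
    define a where "a = - sgn (v $ i) * sgn (v $ j)"
    let ?E = "addrow_mat n a j i" and ?F = "addrow_mat n (- a) j i"
    have E: "?E \<in> carrier_mat n n" and F: "?F \<in> carrier_mat n n" by simp_all
    have EF: "?E * ?F = 1\<^sub>m n" using addrow_mat_inv[of j n i a] ij by simp
    have FE: "?F * ?E = 1\<^sub>m n" using addrow_mat_inv[of j n i "- a"] ij by simp
    define w where "w = ?E *\<^sub>v v"
    have w: "w \<in> carrier_vec n" unfolding w_def by (rule mult_mat_vec_carrier[OF E v])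
    have w_eq: "w $ r = v $ r + (if r = j then a * v $ i else 0)" if r: "r < n" for r
    proof -
      have "w $ r = (\<Sum>l<n. (if r = l then v $ l else 0) +
          (if l = i then (if r = j then a * v $ i else 0) else 0))"
        unfolding w_def index_mult_mat_vec_sum[OF E v r]
        using r ij(3) by (intro sum.cong) (auto simp: algebra_simps)
      also have "\<dots> = v $ r + (if r = j then a * v $ i else 0)"
        unfolding sum.distrib using r ij by simp
      finally show ?thesis .
    qed
    have "\<bar>v $ j + a * v $ i\<bar> < \<bar>v $ j\<bar>"
      using ij(4,5) unfolding a_def by (auto simp: sgn_if split: if_splits)
    then have "(\<Sum>l<n. nat \<bar>w $ l\<bar>) < (\<Sum>l<n. nat \<bar>v $ l\<bar>)"
      using ij by (intro sum_strict_mono_ex1) (auto simp: w_eq intro!: bexI[of _ j])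
    from less.hyps[OF this w] obtain U V where U: "U \<in> carrier_mat n n" and V: "V \<in> carrier_mat n n"
      and UV: "U * V = 1\<^sub>m n" "V * U = 1\<^sub>m n" and z: "\<forall>i\<in>{1..<n}. (U *\<^sub>v w) $ i = 0" by blast
    have "(U * ?E) * (?F * V) = 1\<^sub>m n" "(?F * V) * (U * ?E) = 1\<^sub>m n"
      using mult_mat_inverse_pairs[OF U E F V] mult_mat_inverse_pairs[OF F V U E] UV EF FE by auto
    moreover have "(U * ?E) *\<^sub>v v = U *\<^sub>v w"
      unfolding w_def using U E v by (intro assoc_mult_mat_vec) auto
    ultimately show ?thesis using z U V E F
      by (intro exI[of _ "U * ?E"] exI[of _ "?F * V"]) auto
  next
    case False
    show ?thesis
    proof (cases "n = 0")
      case True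
      then show ?thesis by (intro exI[of _ "1\<^sub>m n"]) auto
    next
      case n: False
      \<comment> \<open>Any two nonzero entries are comparable in absolute value, so failure of the
        case condition leaves at most one nonzero entry. A swap then moves it to the front.\<close>
      have "\<exists>p<n. \<forall>q<n. q \<noteq> p \<longrightarrow> v $ q = 0"
      proof (cases "\<exists>p<n. v $ p \<noteq> 0")
        case True
        then obtain p where p: "p < n" "v $ p \<noteq> 0" by blast
        then have "v $ q = 0" if "q < n" "q \<noteq> p" for q
          using that False linear[of "\<bar>v $ p\<bar>" "\<bar>v $ q\<bar>"] by metis
        then show ?thesis using p by blast
      qed (use n in auto)
      then obtain p where p: "p < n" "\<And>q. q < n \<Longrightarrow> q \<noteq> p \<Longrightarrow> v $ q = 0" by blast
      let ?E = "swaprows_mat n 0 p :: int mat"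
      have "(?E *\<^sub>v v) $ i = 0" if "i \<in> {1..<n}" for i
        using that p v by (auto simp: scalar_prod_def intro!: sum.neutral)
      then show ?thesis using swaprows_mat_inv[of 0 n p] n p(1)
        by (intro exI[of _ ?E]) auto
    qed
  qed
qed

lemma mult_four_block_one_zero:
  fixes A B :: "'a :: comm_ring_1 mat"
  assumes "A \<in> carrier_mat n n" "B \<in> carrier_mat n n" "A * B = 1\<^sub>m n"
  shows "four_block_mat (1\<^sub>m 1) (0\<^sub>m 1 n) (0\<^sub>m n 1) A * four_block_mat (1\<^sub>m 1) (0\<^sub>m 1 n) (0\<^sub>m n 1) B
    = 1\<^sub>m (Suc n)"
  using assms by (subst mult_four_block_mat[of _ 1 1 _ n _ n _ _ 1 _ n]) auto

text \<open>Gaussian elimination over the integers, column by column: once the first column is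
  cleared below its top entry, the induction hypothesis applies to the block without first row and
  column. The rows of \<open>U\<close> from index \<open>k\<close> on annihilate all columns of
  \<open>A\<close>, which makes them candidates for a basis of an orthogonal lattice.\<close>

lemma unimodular_triangularize:
  fixes A :: "int mat"
  assumes "A \<in> carrier_mat n k"
  shows "\<exists>U V. U \<in> carrier_mat n n \<and> V \<in> carrier_mat n n \<and> U * V = 1\<^sub>m n \<and> V * U = 1\<^sub>m n \<and>
    (\<forall>i\<in>{k..<n}. \<forall>j<k. (U * A) $$ (i, j) = 0)"
  using assms
proof (induction k arbitrary: n A)
  case 0
  then show ?case by (intro exI[of _ "1\<^sub>m n"]) auto
next
  case (Suc k)
  note A = Suc.prems
  show ?case
  proof (cases n)
    case 0
    then show ?thesis by (intro exI[of _ "1\<^sub>m n"]) auto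
  next
    case n: (Suc n')
    have "col A 0 \<in> carrier_vec n" using A by auto
    from unimodular_zero_tail_vec[OF this] obtain U0 V0 where
      U0: "U0 \<in> carrier_mat n n" and V0: "V0 \<in> carrier_mat n n"
      and UV0: "U0 * V0 = 1\<^sub>m n" "V0 * U0 = 1\<^sub>m n"
      and z0: "\<forall>i\<in>{1..<n}. (U0 *\<^sub>v col A 0) $ i = 0" by blast
    define A0 where "A0 = U0 * A"
    have A0: "A0 \<in> carrier_mat n (Suc k)" unfolding A0_def using U0 A by simp
    have A0_0: "A0 $$ (Suc i, 0) = 0" if "i < n'" for i
      using z0 that U0 A n by (auto simp: A0_def)
    define A1 where "A1 = mat n' k (\<lambda>(i, j). A0 $$ (Suc i, Suc j))"
    have "A1 \<in> carrier_mat n' k" unfolding A1_def by simp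
    from Suc.IH[OF this] obtain U1 V1 where
      U1: "U1 \<in> carrier_mat n' n'" and V1: "V1 \<in> carrier_mat n' n'"
      and UV1: "U1 * V1 = 1\<^sub>m n'" "V1 * U1 = 1\<^sub>m n'"
      and z1: "\<forall>i\<in>{k..<n'}. \<forall>j<k. (U1 * A1) $$ (i, j) = 0" by blast
    let ?B = "\<lambda>X. four_block_mat (1\<^sub>m 1) (0\<^sub>m 1 n') (0\<^sub>m n' 1) X :: int mat"
    have BU: "?B U1 \<in> carrier_mat n n" and BV: "?B V1 \<in> carrier_mat n n" using U1 V1 n by auto
    have B1: "?B U1 * ?B V1 = 1\<^sub>m n" and B2: "?B V1 * ?B U1 = 1\<^sub>m n"
      unfolding n using mult_four_block_one_zero U1 V1 UV1 by blast+
    have "(?B U1 * U0) * (V0 * ?B V1) = 1\<^sub>m n" "(V0 * ?B V1) * (?B U1 * U0) = 1\<^sub>m n"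
      using mult_mat_inverse_pairs[OF BU U0 V0 BV] mult_mat_inverse_pairs[OF V0 BV BU U0]
        UV0 B1 B2 by blast+
    moreover have "((?B U1 * U0) * A) $$ (i, j) = 0" if i: "i \<in> {Suc k..<n}" and j: "j < Suc k" for i j
    proof -
      obtain i' where i': "i = Suc i'" "k \<le> i'" "i' < n'" using i n by (cases i) auto
      \<comment> \<open>Below the top, each row of the bordered matrix starts with 0. Hence the top
        row of \<open>A0\<close> does not enter; in the other rows column 0 is already zero and the
        remaining columns form \<open>A1\<close>.\<close>
      have BUe: "?B U1 $$ (Suc i', l) = (if l = 0 then 0 else U1 $$ (i', l - 1))" if "l < Suc n'" for l
        using i' that U1 by auto
      have "(?B U1 * U0) * A = ?B U1 * A0"
        unfolding A0_def using BU U0 A by simp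
      then have "((?B U1 * U0) * A) $$ (i, j) = (\<Sum>l<Suc n'. ?B U1 $$ (Suc i', l) * A0 $$ (l, j))"
        using index_mult_mat_sum[OF BU A0, of i j] i j i' n by simp
      also have "\<dots> = (\<Sum>l<n'. U1 $$ (i', l) * A0 $$ (Suc l, j))"
        unfolding sum.lessThan_Suc_shift by (simp add: BUe del: One_nat_def)
      also have "\<dots> = 0"
      proof (cases j)
        case 0
        then show ?thesis using A0_0 by simp
      next
        case (Suc j')
        have "(\<Sum>l<n'. U1 $$ (i', l) * A0 $$ (Suc l, j)) = (U1 * A1) $$ (i', j')"
          using Suc j i' U1 by (simp add: A1_def scalar_prod_def atLeast0LessThan)
        then show ?thesis using z1 i' Suc j by simp
      qed
      finally show ?thesis .
    qed
    ultimately show ?thesis using BU BV U0 V0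
      by (intro exI[of _ "?B U1 * U0"] exI[of _ "V0 * ?B V1"]) auto
  qed
qed

section \<open>Determinants: complementary minors and divisibility\<close>

text \<open>Jacobi's identity for the inverse \<open>K\<close> of \<open>G\<close>. Multiply
  \<open>G\<close> by the matrix formed from the first \<open>k\<close> columns of \<open>K\<close>
  and the last \<open>n - k\<close> unit vectors: the product consists of the first \<open>k\<close>
  unit vectors and the last \<open>n - k\<close> columns of \<open>G\<close>. Both matrices are
  block triangular, and comparing determinants needs no division.\<close>

lemma det_complementary_block:
  fixes G K :: "'a :: idom mat"
  assumes G: "G \<in> carrier_mat n n" and K: "K \<in> carrier_mat n n" and GK: "G * K = 1\<^sub>m n" and k: "k \<le> n"
  shows "det (mat (n - k) (n - k) (\<lambda>(i, j). G $$ (i + k, j + k))) =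
    det G * det (mat k k (\<lambda>(i, j). K $$ (i, j)))"
proof -
  define l where "l = n - k"
  have n: "n = k + l" using k by (simp add: l_def)
  let ?P = "mat k k (\<lambda>(i, j). K $$ (i, j))"
  let ?R = "mat l k (\<lambda>(i, j). K $$ (i + k, j))"
  let ?B = "mat k l (\<lambda>(i, j). G $$ (i, j + k))"
  let ?D = "mat l l (\<lambda>(i, j). G $$ (i + k, j + k))"
  let ?M = "four_block_mat ?P (0\<^sub>m k l) ?R (1\<^sub>m l)"
  have M: "?M \<in> carrier_mat n n" using n by simp
  have "G * ?M = four_block_mat (1\<^sub>m k) ?B (0\<^sub>m l k) ?D"
  proof (rule eq_matI)
    fix i j assume "i < dim_row (four_block_mat (1\<^sub>m k) ?B (0\<^sub>m l k) ?D)"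
      and "j < dim_col (four_block_mat (1\<^sub>m k) ?B (0\<^sub>m l k) ?D)"
    then have i: "i < n" and j: "j < n" using n by auto
    show "(G * ?M) $$ (i, j) = four_block_mat (1\<^sub>m k) ?B (0\<^sub>m l k) ?D $$ (i, j)"
    proof (cases "j < k")
      case True
      have "col ?M j = col K j"
        using True K n by (intro eq_vecI) auto
      then have "(G * ?M) $$ (i, j) = (G * K) $$ (i, j)" using G K M i j
        by (simp del: index_mat_four_block)
      then show ?thesis using GK i j True n by auto
    next
      case False
      have "col ?M j = unit_vec n j"
        using False j n by (intro eq_vecI) auto
      then have "(G * ?M) $$ (i, j) = G $$ (i, j)" using G M i j
        by (simp del: index_mat_four_block)
      then show ?thesis using i j False n by auto
    qed
  qed (use G n in auto)
  moreover have "det (G * ?M) = det G * det ?P"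
    using det_mult[OF G M] by (simp add: det_four_block_mat_upper_right_zero[of _ k _ l])
  moreover have "det (four_block_mat (1\<^sub>m k) ?B (0\<^sub>m l k) ?D) = det ?D"
    by (simp add: det_four_block_mat_lower_left_zero[of _ k _ l])
  ultimately show ?thesis unfolding l_def by simp
qed

text \<open>Subtracting from each row the right multiple of row 0 leaves a row divisible by
  \<open>q\<close>, so one factor \<open>q\<close> comes out of each of the \<open>k\<close> rows
  below the first.\<close>

lemma power_dvd_det_of_proportional_rows:
  fixes A :: "int mat"
  assumes A: "A \<in> carrier_mat (Suc k) (Suc k)"
    and a: "\<And>i j. i < Suc k \<Longrightarrow> 0 < i \<Longrightarrow> j < Suc k \<Longrightarrow> q dvd A $$ (i, j) - a i * A $$ (0, j)"
  shows "q ^ k dvd det A"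
proof -
  let ?n = "Suc k"
  \<comment> \<open>\<open>A = F B\<close> with \<open>F\<close> triangular of diagonal \<open>1, q, \<dots>, q\<close>.\<close>
  define F where "F = mat ?n ?n (\<lambda>(i, j). if j = 0 then if i = 0 then 1 else a i else if i = j then q else 0)"
  define B where "B = mat ?n ?n (\<lambda>(i, j). if i = 0 then A $$ (0, j)
    else (A $$ (i, j) - a i * A $$ (0, j)) div q)"
  have F: "F \<in> carrier_mat ?n ?n" and B: "B \<in> carrier_mat ?n ?n" by (auto simp: F_def B_def)
  have "A = F * B"
  proof (rule eq_matI)
    fix i j assume "i < dim_row (F * B)" and "j < dim_col (F * B)"
    then have i: "i < ?n" and j: "j < ?n" using F B by auto
    have "(F * B) $$ (i, j) = (\<Sum>l<?n. F $$ (i, l) * B $$ (l, j))"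
      using F B i j by (simp add: scalar_prod_def atLeast0LessThan)
    also have "\<dots> = F $$ (i, 0) * B $$ (0, j) + (\<Sum>l<k. F $$ (i, Suc l) * B $$ (Suc l, j))"
      unfolding sum.lessThan_Suc_shift by simp
    also have "(\<Sum>l<k. F $$ (i, Suc l) * B $$ (Suc l, j)) = (\<Sum>l<k. if i = Suc l then q * B $$ (i, j) else 0)"
      using i by (intro sum.cong) (auto simp: F_def)
    also have "\<dots> = (if i = 0 then 0 else q * B $$ (i, j))"
      using i by (cases i) (auto simp: sum.delta)
    also have "F $$ (i, 0) * B $$ (0, j) + \<dots> = A $$ (i, j)"
      using i j a[OF i _ j] by (auto simp: F_def B_def)
    finally show "A $$ (i, j) = (F * B) $$ (i, j)" by simp
  qed (use A F B in auto)
  moreover have "det F = q ^ k"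
  proof -
    have "det F = prod_list (diag_mat F)"
      by (rule det_lower_triangular[OF _ F]) (auto simp: F_def)
    also have "\<dots> = (\<Prod>i<?n. F $$ (i, i))"
      using F by (simp add: prod_list_diag_prod atLeast0LessThan)
    also have "\<dots> = q ^ k"
      unfolding prod.lessThan_Suc_shift by (simp add: F_def)
    finally show ?thesis .
  qed
  ultimately show ?thesis using det_mult[OF F B] by simp
qed

subsection \<open>Hadamard's inequality\<close>

lemma gram_mat_index:
  assumes "M \<in> carrier_mat k n" "i < k" "j < k"
  shows "(M * transpose_mat M) $$ (i, j) = row M i \<bullet> row M j"
  using assms by simp

lemma scalar_prod_self_nonneg: "0 \<le> (v :: real vec) \<bullet> v"
  by (auto simp: scalar_prod_def intro!: sum_nonneg)

lemma scalar_prod_self_eq_0D: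
  fixes v :: "real vec"
  assumes "v \<in> carrier_vec n" "v \<bullet> v = 0"
  shows "v = 0\<^sub>v n"
proof (rule eq_vecI)
  fix i assume "i < dim_vec (0\<^sub>v n :: real vec)"
  then show "v $ i = 0\<^sub>v n $ i"
    using assms by (simp add: scalar_prod_def sum_nonneg_eq_0_iff)
qed (use assms in simp)

text \<open>Gram-Schmidt by induction on the number of rows: the last row contributes to the Gram
  determinant only through its component orthogonal to the other rows, and this component is no
  longer than the row itself.\<close>

lemma gram_det_hadamard:
  fixes M :: "real mat"
  assumes "M \<in> carrier_mat k n"
  shows "0 \<le> det (M * transpose_mat M) \<and> det (M * transpose_mat M) \<le> (\<Prod>i<k. row M i \<bullet> row M i)"
  using assms
proof (induction k arbitrary: M)
  case 0
  then have "M * transpose_mat M \<in> carrier_mat 0 0" by auto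
  then show ?case by (simp add: det_dim_zero)
next
  case (Suc k)
  note M = Suc.prems
  define M' where "M' = mat k n (\<lambda>(i, j). M $$ (i, j))"
  define v where "v = row M k"
  let ?G = "M * transpose_mat M" and ?G' = "M' * transpose_mat M'"
  have M': "M' \<in> carrier_mat k n" and v: "v \<in> carrier_vec n" using M by (auto simp: M'_def v_def)
  have Mt: "transpose_mat M \<in> carrier_mat n (Suc k)" and Mt': "transpose_mat M' \<in> carrier_mat n k"
    using M M' by auto
  have G: "?G \<in> carrier_mat (Suc k) (Suc k)" and G': "?G' \<in> carrier_mat k k" using M M' by auto
  have rowM': "row M' i = row M i" if "i < k" for i
    using that M by (auto simp: M'_def)
  have IH: "0 \<le> det ?G'" "det ?G' \<le> (\<Prod>i<k. row M i \<bullet> row M i)"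
    using Suc.IH[OF M'] by (auto simp: rowM')
  show ?case
  proof (cases "det ?G' = 0")
    case True
    \<comment> \<open>A kernel vector \<open>x\<close> of \<open>?G'\<close> is a linear relation
      between the rows of \<open>M'\<close>, because the combination \<open>u\<close> has squared
      length \<open>x \<bullet> (?G' x) = 0\<close>. Padding \<open>x\<close> with a 0 gives a
      relation between all rows, so the larger Gram determinant vanishes as well.\<close>
    then obtain x where x: "x \<in> carrier_vec k" "x \<noteq> 0\<^sub>v k" "?G' *\<^sub>v x = 0\<^sub>v k"
      using det_0_iff_vec_prod_zero[OF G'] by blast
    define u where "u = transpose_mat M' *\<^sub>v x"
    have u: "u \<in> carrier_vec n" unfolding u_def using mult_mat_vec_carrier[OF Mt' x(1)] .
    have M'u: "M' *\<^sub>v u = 0\<^sub>v k"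
      unfolding u_def using assoc_mult_mat_vec[OF M' Mt' x(1)] x(3) by simp
    have "u \<bullet> u = x \<bullet> (M' *\<^sub>v u)"
      using transpose_vec_mult_scalar[OF M' u x(1)] unfolding u_def
      by (simp add: u_def)
    then have "u \<bullet> u = 0" using M'u x(1) by simp
    then have u0: "u = 0\<^sub>v n" by (rule scalar_prod_self_eq_0D[OF u])
    define y where "y = vec (Suc k) (\<lambda>i. if i < k then x $ i else 0)"
    have y: "y \<in> carrier_vec (Suc k)" by (simp add: y_def)
    have "transpose_mat M *\<^sub>v y = u"
    proof (rule eq_vecI)
      fix j assume "j < dim_vec u"
      then have j: "j < n" using u by simp
      show "(transpose_mat M *\<^sub>v y) $ j = u $ j"
        unfolding u_def index_mult_mat_vec_sum[OF Mt y j] index_mult_mat_vec_sum[OF Mt' x(1) j]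
        using M j by (simp add: y_def M'_def)
    qed (use u Mt in auto)
    then have "?G *\<^sub>v y = M *\<^sub>v 0\<^sub>v n"
      using assoc_mult_mat_vec[OF M Mt y] u0 by simp
    also have "\<dots> = 0\<^sub>v (Suc k)" using M by (intro eq_vecI) auto
    finally have "?G *\<^sub>v y = 0\<^sub>v (Suc k)" .
    moreover have "y \<noteq> 0\<^sub>v (Suc k)"
    proof
      assume y0: "y = 0\<^sub>v (Suc k)"
      have "x = 0\<^sub>v k"
      proof (rule eq_vecI)
        fix i assume "i < dim_vec (0\<^sub>v k :: real vec)"
        then show "x $ i = 0\<^sub>v k $ i" using arg_cong[OF y0, of "\<lambda>z. z $ i"] by (simp add: y_def)
      qed (use x in auto)
      then show False using x by simp
    qed
    ultimately have "det ?G = 0" using det_0_iff_vec_prod_zero[OF G] y by blast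
    then show ?thesis by (auto intro!: mult_nonneg_nonneg prod_nonneg scalar_prod_self_nonneg)
  next
    case False
    obtain K where K: "?G' * K = 1\<^sub>m k" "K \<in> carrier_mat k k"
      using det_non_zero_imp_unit[OF G' False, of "()"] by (auto simp: Units_def ring_mat_def)
    define b where "b = M' *\<^sub>v v"
    \<comment> \<open>This solves the normal equations: \<open>u\<close> below is the orthogonal
      projection of \<open>v\<close> onto the row space of \<open>M'\<close>, and \<open>w\<close>
      is orthogonal to every row of \<open>M'\<close>.\<close>
    define x where "x = K *\<^sub>v b"
    have b: "b \<in> carrier_vec k" unfolding b_def by (rule mult_mat_vec_carrier[OF M' v])
    have x: "x \<in> carrier_vec k" unfolding x_def by (rule mult_mat_vec_carrier[OF K(2) b])
    have Gx: "?G' *\<^sub>v x = b"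
      unfolding x_def assoc_mult_mat_vec[OF G' K(2) b, symmetric] K(1) using b by simp
    define u where "u = transpose_mat M' *\<^sub>v x"
    define w where "w = v - u"
    have u: "u \<in> carrier_vec n" unfolding u_def by (rule mult_mat_vec_carrier[OF Mt' x])
    have w: "w \<in> carrier_vec n" unfolding w_def using u v by simp
    have M'w: "M' *\<^sub>v w = 0\<^sub>v k"
      unfolding w_def mult_minus_distrib_mat_vec[OF M' v u] b_def[symmetric]
      using assoc_mult_mat_vec[OF M' Mt' x] Gx b by (simp add: u_def)
    have rw: "row M' i \<bullet> w = 0" if "i < k" for i
      using arg_cong[OF M'w, of "\<lambda>z. z $ i"] that M' by simp
    have uw: "u \<bullet> w = 0"
      using transpose_vec_mult_scalar[OF M' w x] M'w x unfolding u_def by simp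
    have vv: "v \<bullet> v = w \<bullet> w + u \<bullet> u"
    proof -
      have v_eq: "v = u + w" using u v by (auto simp: w_def)
      show ?thesis
        unfolding v_eq add_scalar_prod_distrib[OF u w add_carrier_vec[OF u w]]
          scalar_prod_add_distrib[OF u u w] scalar_prod_add_distrib[OF w u w]
        using uw comm_scalar_prod[OF w u] by simp
    qed
    \<comment> \<open>The row operation that replaces the last row \<open>v\<close> by its component \<open>w\<close> orthogonal to the others.\<close>
    define E where "E = mat (Suc k) (Suc k) (\<lambda>(i, j). if i = j then 1 else if i = k then - x $ j else 0)"
    have E: "E \<in> carrier_mat (Suc k) (Suc k)" by (simp add: E_def)
    have detE: "det E = 1"
    proof -
      have "det E = prod_list (diag_mat E)"
        by (rule det_lower_triangular[OF _ E]) (auto simp: E_def)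
      also have "\<dots> = 1"
        using E by (simp add: prod_list_diag_prod E_def)
      finally show ?thesis .
    qed
    let ?M2 = "E * M"
    have M2: "?M2 \<in> carrier_mat (Suc k) n" using E M by simp
    have row2: "row ?M2 i = (if i < k then row M' i else w)" if i: "i < Suc k" for i
    proof (rule eq_vecI)
      fix j assume "j < dim_vec (if i < k then row M' i else w)"
      then have j: "j < n" using M' w by (auto split: if_splits)
      have "row ?M2 i $ j = (\<Sum>l<k. E $$ (i, l) * M $$ (l, j)) + E $$ (i, k) * M $$ (k, j)"
        using index_mult_mat_sum[OF E M i j] index_row(1)[of i ?M2 j] i j E M by simp
      also have "\<dots> = (if i < k then row M' i else w) $ j"
      proof (cases "i < k")
        case True
        have "(\<Sum>l<k. E $$ (i, l) * M $$ (l, j)) = (\<Sum>l<k. if i = l then M $$ (i, j) else 0)"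
          using True by (intro sum.cong) (auto simp: E_def)
        then show ?thesis using True j M by (simp add: E_def rowM')
      next
        case False
        then have ik: "i = k" using i by simp
        have "(\<Sum>l<k. E $$ (i, l) * M $$ (l, j)) = - u $ j"
          unfolding u_def index_mult_mat_vec_sum[OF Mt' x j] sum_negf[symmetric]
          using ik j by (intro sum.cong) (auto simp: E_def M'_def)
        then show ?thesis using ik j M u v by (simp add: E_def w_def v_def)
      qed
      finally show "row ?M2 i $ j = (if i < k then row M' i else w) $ j" .
    qed (use M2 M' w in auto)
    \<comment> \<open>The rows of \<open>?M2\<close> are those of \<open>M'\<close> followed by
      \<open>w\<close>, so orthogonality makes the Gram matrix block diagonal. As \<open>E\<close>
      has determinant 1, its determinant is still \<open>det ?G\<close>.\<close>
    have "?M2 * transpose_mat ?M2 =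
      four_block_mat ?G' (0\<^sub>m k 1) (0\<^sub>m 1 k) (mat 1 1 (\<lambda>_. w \<bullet> w))" (is "_ = ?Q")
    proof (rule eq_matI)
      fix i j assume "i < dim_row ?Q" and "j < dim_col ?Q"
      then have i: "i < Suc k" and j: "j < Suc k" using M' by auto
      have "(?M2 * transpose_mat ?M2) $$ (i, j) = row ?M2 i \<bullet> row ?M2 j"
        by (rule gram_mat_index[OF M2 i j])
      also have "\<dots> = ?Q $$ (i, j)"
        using i j M' rw comm_scalar_prod[OF w, of "row M' j"] by (auto simp: row2)
      finally show "(?M2 * transpose_mat ?M2) $$ (i, j) = ?Q $$ (i, j)" .
    qed (use M2 M' E in auto)
    then have d1: "det (?M2 * transpose_mat ?M2) = det ?G' * (w \<bullet> w)"
      using G' by (simp add: det_four_block_mat_lower_left_zero[of _ k _ 1] det_single)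
    have "?M2 * transpose_mat ?M2 = E * ?G * transpose_mat E"
    proof -
      have Et: "transpose_mat E \<in> carrier_mat (Suc k) (Suc k)" using E by simp
      show ?thesis
        unfolding transpose_mult[OF E M] assoc_mult_mat[OF E M mult_carrier_mat[OF Mt Et]]
          assoc_mult_mat[OF E G Et] assoc_mult_mat[OF M Mt Et] ..
    qed
    then have "det (?M2 * transpose_mat ?M2) = det ?G"
      using det_mult[OF mult_carrier_mat[OF E G], of "transpose_mat E"] det_mult[OF E G]
        det_transpose[OF E] E detE by simp
    then have dG: "det ?G = det ?G' * (w \<bullet> w)" using d1 by simp
    have ww: "0 \<le> w \<bullet> w" "w \<bullet> w \<le> v \<bullet> v"
      using vv scalar_prod_self_nonneg[of w] scalar_prod_self_nonneg[of u] by auto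
    have "det ?G' * (w \<bullet> w) \<le> (\<Prod>i<k. row M i \<bullet> row M i) * (v \<bullet> v)"
      using IH ww by (intro mult_mono) (auto intro!: prod_nonneg scalar_prod_self_nonneg)
    then show ?thesis using dG IH(1) ww(1) by (simp add: v_def)
  qed
qed

subsection \<open>Orthogonal lattices\<close>

lemma lattice_of_eq_image:
  fixes fs :: "'a :: comm_ring_1 vec list"
  assumes fs: "set fs \<subseteq> carrier_vec n"
  shows "vec_module.lattice_of n fs =
    (\<lambda>y. transpose_mat (mat_of_rows n fs) *\<^sub>v map_vec of_int y) ` carrier_vec (length fs)"
proof -
  interpret vec_module "TYPE('a)" n .
  let ?M = "transpose_mat (mat_of_rows n fs)"
  have M: "?M \<in> carrier_mat n (length fs)" by simp
  have nth: "fs ! i \<in> carrier_vec n" if "i < length fs" for i using fs that by auto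
  have eq: "sumlist (map (\<lambda>i. of_int (a i) \<cdot>\<^sub>v fs ! i) [0..<length fs]) =
      ?M *\<^sub>v map_vec of_int (vec (length fs) a)"
    (is "?l = ?r") for a
  proof (rule eq_vecI)
    have dim: "dim_vec (fs ! i) = n" if "i < length fs" for i using nth[OF that] by simp
    fix j assume "j < dim_vec ?r"
    then have j: "j < n" by simp
    have "?l $ j = (\<Sum>i = 0..<length fs. of_int (a i) * fs ! i $ j)"
      using sumlist_nth[of "map (\<lambda>i. of_int (a i) \<cdot>\<^sub>v fs ! i) [0..<length fs]" j] j dim
      by auto
    also have "\<dots> = ?r $ j"
      using index_mult_mat_vec_sum[OF M, of "map_vec of_int (vec (length fs) a)" j] j
      by (auto simp: mat_of_rows_index atLeast0LessThan mult.commute intro!: sum.cong)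
    finally show "?l $ j = ?r $ j" .
  next
    have "dim_vec ?l = n" by (rule sumlist_dim) (use nth in auto)
    then show "dim_vec ?l = dim_vec ?r" by simp
  qed
  show ?thesis
  proof (intro equalityI subsetI)
    fix x assume "x \<in> lattice_of fs"
    then show "x \<in> (\<lambda>y. ?M *\<^sub>v map_vec of_int y) ` carrier_vec (length fs)"
      unfolding lattice_of_def eq by auto
  next
    fix x assume "x \<in> (\<lambda>y. ?M *\<^sub>v map_vec of_int y) ` carrier_vec (length fs)"
    then obtain y where y: "y \<in> carrier_vec (length fs)" "x = ?M *\<^sub>v map_vec of_int y" by blast
    have "vec (length fs) (\<lambda>i. y $ i) = y" using y(1) by auto
    then have "x = sumlist (map (\<lambda>i. of_int (y $ i) \<cdot>\<^sub>v fs ! i) [0..<length fs])"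
      using eq[of "\<lambda>i. y $ i"] y(2) by simp
    then show "x \<in> lattice_of fs" by (rule in_latticeI)
  qed
qed

text \<open>Orthogonality to a span can be tested on generators, which brings the rational
  definition back to integer combinations of \<open>bs\<close>. Moving the matrix across the scalar
  product and testing with unit vectors leaves a homogeneous integer system.\<close>

lemma lattice_perp_lattice_of:
  assumes bs: "set bs \<subseteq> carrier_vec n"
  shows "lattice_perp n (vec_module.lattice_of n bs) =
    {x \<in> carrier_vec n. mat_of_rows n bs *\<^sub>v x = 0\<^sub>v (length bs)}"
proof -
  interpret R: vec_space "TYPE(rat)" n .
  interpret Z: vec_module "TYPE(int)" n .
  let ?L = "Z.lattice_of bs" and ?h = "map_vec rat_of_int" and ?M = "mat_of_rows n bs"
  have M: "?M \<in> carrier_mat (length bs) n" by simp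
  have L: "?L = (\<lambda>y. transpose_mat ?M *\<^sub>v y) ` carrier_vec (length bs)"
  proof -
    have "map_vec of_int y = y" for y :: "int vec" by (intro eq_vecI) auto
    then show ?thesis using lattice_of_eq_image[OF bs] by simp
  qed
  have Lc: "?L \<subseteq> carrier_vec n"
    unfolding L by (auto intro!: mult_mat_vec_carrier[of _ _ "length bs"])
  then have hL: "?h ` ?L \<subseteq> carrier_vec n" by auto
  have h: "?h x \<bullet> ?h y = 0 \<longleftrightarrow> x \<bullet> y = 0" if "x \<in> carrier_vec n" "y \<in> ?L" for x y
  proof -
    have "?h x \<bullet> ?h y = rat_of_int (x \<bullet> y)" using that Lc by (auto simp: scalar_prod_def)
    then show ?thesis by simp
  qed
  have "R.orthogonal_complement (rat_span n ?L) = {x \<in> carrier_vec n. \<forall>y\<in>?h ` ?L. x \<bullet> y = 0}"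
    unfolding rat_span_def R.in_orthogonal_complement_span[OF hL]
    by (simp add: R.orthogonal_complement_def)
  then have "x \<in> lattice_perp n ?L \<longleftrightarrow> x \<in> carrier_vec n \<and> (\<forall>y\<in>?L. x \<bullet> y = 0)" for x
    unfolding lattice_perp_def
    using h by auto
  also have "\<dots> x \<longleftrightarrow> x \<in> carrier_vec n \<and> (\<forall>y\<in>carrier_vec (length bs). y \<bullet> (?M *\<^sub>v x) = 0)" for x
  proof -
    have "x \<bullet> (transpose_mat ?M *\<^sub>v y) = y \<bullet> (?M *\<^sub>v x)"
      if "x \<in> carrier_vec n" "y \<in> carrier_vec (length bs)" for y
      using transpose_vec_mult_scalar[OF M that] Lc that
        comm_scalar_prod[of x n "transpose_mat ?M *\<^sub>v y"] by (auto simp: L)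
    then show ?thesis unfolding L by auto
  qed
  also have "\<dots> x \<longleftrightarrow> x \<in> carrier_vec n \<and> ?M *\<^sub>v x = 0\<^sub>v (length bs)" for x
  proof (intro conj_cong refl iffI ballI)
    assume x: "x \<in> carrier_vec n" and *: "\<forall>y\<in>carrier_vec (length bs). y \<bullet> (?M *\<^sub>v x) = 0"
    show "?M *\<^sub>v x = 0\<^sub>v (length bs)"
    proof (rule eq_vecI)
      fix i assume "i < dim_vec (0\<^sub>v (length bs) :: int vec)"
      then have i: "i < length bs" by simp
      have "(?M *\<^sub>v x) $ i = unit_vec (length bs) i \<bullet> (?M *\<^sub>v x)"
        using i mult_mat_vec_carrier[OF M x] by (intro scalar_prod_left_unit[symmetric]) auto
      then show "(?M *\<^sub>v x) $ i = 0\<^sub>v (length bs) $ i" using * i by simp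
    qed simp
  qed auto
  finally show ?thesis by blast
qed

text \<open>The entries of a kernel vector are the coefficients of a linear relation. Working over a
  commutative ring lets independence over the integers be used directly, without passing to the
  rationals.\<close>

lemma lin_indpt_list_kernel:
  fixes bs :: "'a :: comm_ring_1 vec list"
  assumes li: "lin_indpt_list n bs" and x: "x \<in> carrier_vec (length bs)"
    and 0: "transpose_mat (mat_of_rows n bs) *\<^sub>v x = 0\<^sub>v n"
  shows "x = 0\<^sub>v (length bs)"
proof (rule ccontr)
  interpret vec_module "TYPE('a)" n .
  have bs: "set bs \<subseteq> carrier_vec n" "distinct bs" "lin_indpt (set bs)"
    using li unfolding lin_indpt_list_def by auto
  assume "x \<noteq> 0\<^sub>v (length bs)"
  then obtain i where i: "i < length bs" "x $ i \<noteq> 0" using x by (auto simp: vec_eq_iff)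
  \<comment> \<open>A relation on the set of vectors needs coefficients indexed by vectors instead
    of positions; since the list is distinct, only one term of the sum survives at
    \<open>bs ! i\<close>.\<close>
  define f where "f l = (\<Sum>i = 0..<length bs. if l = bs ! i then x $ i else 0)" for l
  have f: "mat_of_cols n bs *\<^sub>v x = lincomb f (set bs)"
    unfolding f_def using x bs(1) by (intro mat_of_cols_mult_as_finsum) auto
  have "f (bs ! i) = (\<Sum>j = 0..<length bs. if i = j then x $ j else 0)"
    unfolding f_def using bs(2) i(1) by (intro sum.cong) (auto simp: nth_eq_iff_index_eq)
  then have "f (bs ! i) \<noteq> 0" using i by simp
  moreover have "lincomb f (set bs) = 0\<^sub>v n" using f 0 by (simp add: transpose_mat_of_rows)
  ultimately have "lin_dep (set bs)"
    unfolding lin_dep_def using i(1) by (intro exI[of _ "set bs"] exI[of _ f] exI[of _ "bs ! i"]) auto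
  then show False using bs(3) by simp
qed

lemma lin_indpt_list_rows:
  fixes M :: "'a :: field mat"
  assumes M: "M \<in> carrier_mat n n" and det: "det M \<noteq> 0"
  shows "lin_indpt_list n (map (\<lambda>i. row M (i + k)) [0..<n - k])"
proof -
  interpret vec_space "TYPE('a)" n .
  let ?bs = "map (\<lambda>i. row M (i + k)) [0..<n - k]"
  have sub: "set ?bs \<subseteq> set (rows M)" using M by (auto simp: rows_def)
  have "row M i \<noteq> row M j" if "i < n" "j < n" "i \<noteq> j" for i j
    using det_identical_rows[OF M that(3,1,2)] det by blast
  then have "inj_on (row M) {0..<n}" unfolding inj_on_def by (metis atLeastLessThan_iff)
  then have "x = y" if "row M (x + k) = row M (y + k)" "x < n - k" "y < n - k" for x y
    using that inj_onD[of "row M" "{0..<n}" "x + k" "y + k"] by auto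
  then have "distinct ?bs" by (auto simp: distinct_map inj_on_def)
  moreover have "lin_indpt (set ?bs)"
    using subset_li_is_li[OF det_not_0_imp_lin_indpt_rows[OF M det] sub] .
  ultimately show ?thesis unfolding lin_indpt_list_def using M by auto
qed

text \<open>With \<open>C\<close> the matrix of rows \<open>bs\<close>, triangularizing
  \<open>C^T\<close> gives \<open>C U^T = [H | 0]\<close>. Thus \<open>C = H Y\<close> for the first
  \<open>k\<close> rows \<open>Y\<close> of \<open>V^T\<close>, and \<open>H = C X\<close> for the
  first \<open>k\<close> columns \<open>X\<close> of \<open>U^T\<close>. The first form relates Gram
  determinants; the second carries congruences between rows of \<open>C\<close> over to
  \<open>H\<close>.\<close>

lemma lattice_perp_unimodular_basis:
  fixes bs :: "int vec list"
  assumes li: "lin_indpt_list n bs" and kn: "length bs \<le> n"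
  defines "k \<equiv> length bs"
  obtains U V H X where "U \<in> carrier_mat n n" "V \<in> carrier_mat n n" "U * V = 1\<^sub>m n" "V * U = 1\<^sub>m n"
    "H \<in> carrier_mat k k" "X \<in> carrier_mat n k"
    "mat_of_rows n bs = H * mat k n (\<lambda>(i, j). V $$ (j, i))"
    "H = mat_of_rows n bs * X" "det H \<noteq> 0"
    "lattice_perp n (vec_module.lattice_of n bs) =
      vec_module.lattice_of n (map (\<lambda>i. row U (i + k)) [0..<n - k])"
proof -
  let ?C = "mat_of_rows n bs" and ?A = "transpose_mat (mat_of_rows n bs)"
  have bs: "set bs \<subseteq> carrier_vec n" using li by (simp add: lin_indpt_list_def)
  have C: "?C \<in> carrier_mat k n" and A: "?A \<in> carrier_mat n k" by (auto simp: k_def)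
  obtain U V where U: "U \<in> carrier_mat n n" and V: "V \<in> carrier_mat n n"
    and UV: "U * V = 1\<^sub>m n" "V * U = 1\<^sub>m n" and z: "\<forall>i\<in>{k..<n}. \<forall>j<k. (U * ?A) $$ (i, j) = 0"
    using unimodular_triangularize[OF A] by blast
  have UA: "U * ?A \<in> carrier_mat n k" using U A by simp
  define H where "H = mat k k (\<lambda>(i, j). (U * ?A) $$ (j, i))"
  define X where "X = mat n k (\<lambda>(i, j). U $$ (j, i))"
  define Y where "Y = mat k n (\<lambda>(i, j). V $$ (j, i))"
  have H: "H \<in> carrier_mat k k" and X: "X \<in> carrier_mat n k" and Y: "Y \<in> carrier_mat k n"
    by (auto simp: H_def X_def Y_def)
  have CH: "?C = H * Y"
  proof (rule eq_matI)
    fix i j assume "i < dim_row (H * Y)" "j < dim_col (H * Y)"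
    then have i: "i < k" and j: "j < n" using H Y by auto
    have "V * (U * ?A) = ?A"
      unfolding assoc_mult_mat[OF V U A, symmetric] UV(2) by (rule left_mult_one_mat[OF A])
    then have "?C $$ (i, j) = (V * (U * ?A)) $$ (j, i)"
      using C i j by (metis carrier_matD index_transpose_mat(1))
    also have "\<dots> = (\<Sum>r<n. V $$ (j, r) * (U * ?A) $$ (r, i))"
      by (rule index_mult_mat_sum[OF V UA j i])
    also have "\<dots> = (\<Sum>r<k. V $$ (j, r) * (U * ?A) $$ (r, i))"
      using z i kn by (intro sum.mono_neutral_right) (auto simp: k_def)
    also have "\<dots> = (H * Y) $$ (i, j)"
      unfolding index_mult_mat_sum[OF H Y i j] using i j
      by (intro sum.cong) (auto simp: H_def Y_def)
    finally show "?C $$ (i, j) = (H * Y) $$ (i, j)" .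
  qed (use C H Y in auto)
  have HX: "H = ?C * X"
  proof (rule eq_matI)
    fix i j assume "i < dim_row (?C * X)" "j < dim_col (?C * X)"
    then have i: "i < k" and j: "j < k" using C X by auto
    then have j': "j < n" using kn by (simp add: k_def)
    have "H $$ (i, j) = (\<Sum>r<n. U $$ (j, r) * ?A $$ (r, i))"
      using i j index_mult_mat_sum[OF U A j' i] by (simp add: H_def)
    also have "\<dots> = (?C * X) $$ (i, j)"
      unfolding index_mult_mat_sum[OF C X i j] using C i j
      by (intro sum.cong) (auto simp: X_def)
    finally show "H $$ (i, j) = (?C * X) $$ (i, j)" .
  qed (use C H X in auto)
  \<comment> \<open>Since \<open>C^T = Y^T H^T\<close>, a nonzero kernel vector of
    \<open>H^T\<close> would be a linear relation between the vectors of \<open>bs\<close>.\<close>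
  have detH: "det H \<noteq> 0"
  proof
    assume "det H = 0"
    then have "det (transpose_mat H) = 0" using det_transpose[OF H] by simp
    then obtain x where x: "x \<in> carrier_vec k" "x \<noteq> 0\<^sub>v k" "transpose_mat H *\<^sub>v x = 0\<^sub>v k"
      using det_0_iff_vec_prod_zero[of "transpose_mat H" k] H by auto
    have Yt: "transpose_mat Y \<in> carrier_mat n k" and Ht: "transpose_mat H \<in> carrier_mat k k"
      using Y H by auto
    have "?A *\<^sub>v x = transpose_mat Y *\<^sub>v (transpose_mat H *\<^sub>v x)"
      unfolding CH transpose_mult[OF H Y] by (rule assoc_mult_mat_vec[OF Yt Ht x(1)])
    also have "\<dots> = 0\<^sub>v n" unfolding x(3) using Yt by (intro eq_vecI) auto
    finally have "?A *\<^sub>v x = 0\<^sub>v n" .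
    then show False using lin_indpt_list_kernel[OF li] x(1,2) by (simp add: k_def)
  qed
  let ?bs = "map (\<lambda>i. row U (i + k)) [0..<n - k]"
  have bs': "set ?bs \<subseteq> carrier_vec n" using U by auto
  have len: "length ?bs = n - k" by simp
  let ?B = "transpose_mat (mat_of_rows n ?bs)"
  have B: "?B \<in> carrier_mat n (n - k)" by (rule carrier_matI) simp_all
  have B_index: "?B $$ (i, j) = U $$ (j + k, i)" if "i < n" "j < n - k" for i j
    using that U by (simp add: mat_of_rows_index)
  have lat: "vec_module.lattice_of n ?bs = (\<lambda>y. ?B *\<^sub>v y) ` carrier_vec (n - k)"
  proof -
    have "map_vec of_int y = y" for y :: "int vec" by (intro eq_vecI) auto
    then show ?thesis using lattice_of_eq_image[OF bs'] by simp
  qed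
  have CU: "?C * transpose_mat U = transpose_mat (U * ?A)"
    using transpose_mult[OF U A] by simp
  have Ut: "transpose_mat U \<in> carrier_mat n n" and Vt: "transpose_mat V \<in> carrier_mat n n" using U V by auto
  \<comment> \<open>The last \<open>n - k\<close> columns of \<open>C U^T\<close> vanish, so only
    the first \<open>k\<close> coordinates of \<open>y\<close> enter.\<close>
  have CUy: "(?C *\<^sub>v (transpose_mat U *\<^sub>v y)) $ i = (\<Sum>r<k. H $$ (i, r) * y $ r)"
    if y: "y \<in> carrier_vec n" and i: "i < k" for y i
  proof -
    have "(?C *\<^sub>v (transpose_mat U *\<^sub>v y)) $ i = (transpose_mat (U * ?A) *\<^sub>v y) $ i"
      unfolding CU[symmetric] assoc_mult_mat_vec[OF C Ut y] ..
    also have "\<dots> = (\<Sum>r<n. (U * ?A) $$ (r, i) * y $ r)"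
    proof -
      have "transpose_mat (U * ?A) $$ (i, r) = (U * ?A) $$ (r, i)" if "r < n" for r
        using UA i that by (metis carrier_matD index_transpose_mat(1))
      then show ?thesis
        using index_mult_mat_vec_sum[of "transpose_mat (U * ?A)" k n y i] y i UA by simp
    qed
    also have "\<dots> = (\<Sum>r<k. (U * ?A) $$ (r, i) * y $ r)"
      using z i kn by (intro sum.mono_neutral_right) (auto simp: k_def)
    finally show ?thesis using i by (simp add: H_def)
  qed
  have split: "transpose_mat U *\<^sub>v y = ?B *\<^sub>v vec (n - k) (\<lambda>i. y $ (i + k))"
    if y: "y \<in> carrier_vec n" and y0: "\<And>i. i < k \<Longrightarrow> y $ i = 0" for y
  proof (rule eq_vecI)
    fix j assume "j < dim_vec (?B *\<^sub>v vec (n - k) (\<lambda>i. y $ (i + k)))"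
    then have j: "j < n" by simp
    have "(transpose_mat U *\<^sub>v y) $ j = (\<Sum>r<n. U $$ (r, j) * y $ r)"
      using index_mult_mat_vec_sum[OF Ut y j] U j by simp
    also have "\<dots> = (\<Sum>r\<in>{k..<n}. U $$ (r, j) * y $ r)"
      using y0 by (intro sum.mono_neutral_right) auto
    also have "\<dots> = (\<Sum>r<n - k. U $$ (r + k, j) * y $ (r + k))"
      by (rule sum.reindex_bij_witness[of _ "\<lambda>r. r + k" "\<lambda>r. r - k"]) auto
    also have "\<dots> = (?B *\<^sub>v vec (n - k) (\<lambda>i. y $ (i + k))) $ j"
      unfolding index_mult_mat_vec_sum[OF B vec_carrier j] using j
      by (intro sum.cong) (auto simp del: index_transpose_mat simp: B_index)
    finally show "(transpose_mat U *\<^sub>v y) $ j = (?B *\<^sub>v vec (n - k) (\<lambda>i. y $ (i + k))) $ j" .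
  qed (use U in auto)
  have "lattice_perp n (vec_module.lattice_of n bs) = vec_module.lattice_of n ?bs"
    unfolding lattice_perp_lattice_of[OF bs] lat k_def[symmetric]
  proof (intro equalityI subsetI)
    fix x assume "x \<in> {x \<in> carrier_vec n. ?C *\<^sub>v x = 0\<^sub>v k}"
    then have x: "x \<in> carrier_vec n" "?C *\<^sub>v x = 0\<^sub>v k" by auto
    \<comment> \<open>These are the coordinates of \<open>x\<close> with respect to the rows of
      \<open>U\<close>. Orthogonality says that \<open>H\<close> annihilates the first
      \<open>k\<close> of them; as \<open>det H\<close> is nonzero they vanish, and the others are
      the required integer coefficients.\<close>
    define y where "y = transpose_mat V *\<^sub>v x"
    have y: "y \<in> carrier_vec n" unfolding y_def by (rule mult_mat_vec_carrier[OF Vt x(1)])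
    have "transpose_mat U *\<^sub>v y = (transpose_mat U * transpose_mat V) *\<^sub>v x"
      unfolding y_def using assoc_mult_mat_vec[OF Ut Vt x(1)] by simp
    also have "transpose_mat U * transpose_mat V = 1\<^sub>m n"
      using transpose_mult[OF V U] UV(2) by simp
    finally have Uy: "transpose_mat U *\<^sub>v y = x" using x(1) by simp
    let ?y = "vec k (\<lambda>i. y $ i)"
    have "H *\<^sub>v ?y = 0\<^sub>v k"
    proof (rule eq_vecI)
      fix i assume "i < dim_vec (0\<^sub>v k :: int vec)"
      then have i: "i < k" by simp
      have "(H *\<^sub>v ?y) $ i = (?C *\<^sub>v x) $ i"
        using CUy[OF y i] index_mult_mat_vec_sum[OF H vec_carrier i, of "\<lambda>i. y $ i"] Uy by simp
      then show "(H *\<^sub>v ?y) $ i = 0\<^sub>v k $ i" using x(2) by simp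
    qed (use H in auto)
    then have y0: "?y = 0\<^sub>v k" using det_0_iff_vec_prod_zero[OF H] detH vec_carrier by blast
    have "y $ i = 0" if "i < k" for i
      using arg_cong[OF y0, of "\<lambda>z. z $ i"] that by simp
    from split[OF y this] Uy show "x \<in> (\<lambda>y. ?B *\<^sub>v y) ` carrier_vec (n - k)"
      by (auto intro!: image_eqI[of _ _ "vec (n - k) (\<lambda>i. y $ (i + k))"])
  next
    fix x assume "x \<in> (\<lambda>y. ?B *\<^sub>v y) ` carrier_vec (n - k)"
    then obtain y where y: "y \<in> carrier_vec (n - k)" "x = ?B *\<^sub>v y" by blast
    define w where "w = vec n (\<lambda>i. if i < k then 0 else y $ (i - k))"
    have w: "w \<in> carrier_vec n" by (simp add: w_def)
    have "vec (n - k) (\<lambda>i. w $ (i + k)) = y" using y(1) by (auto simp: w_def)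
    then have xw: "x = transpose_mat U *\<^sub>v w"
      using split[OF w] y(2) kn by (simp add: w_def k_def)
    have "?C *\<^sub>v x = 0\<^sub>v k"
    proof (rule eq_vecI)
      fix i assume "i < dim_vec (0\<^sub>v k :: int vec)"
      then have i: "i < k" by simp
      show "(?C *\<^sub>v x) $ i = 0\<^sub>v k $ i"
        unfolding xw CUy[OF w i] using i kn by (simp add: w_def k_def)
    qed (use C in auto)
    moreover have "x \<in> carrier_vec n" unfolding y(2) by (rule mult_mat_vec_carrier[OF B y(1)])
    ultimately show "x \<in> {x \<in> carrier_vec n. ?C *\<^sub>v x = 0\<^sub>v k}" by simp
  qed
  then show thesis using that U V UV H X CH HX detH unfolding Y_def by blast
qed

text \<open>Integer combinations commute with the linear map, so generators are carried to
  generators.\<close>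

lemma lattice_transform_lattice_of:
  assumes bs: "set bs \<subseteq> carrier_vec n" and T: "T \<in> carrier_mat n n"
  shows "lattice_transform T (vec_module.lattice_of n bs) =
    vec_module.lattice_of n (map (\<lambda>b. transpose_mat T *\<^sub>v map_vec real_of_int b) bs)"
proof -
  let ?l = "length bs" and ?f = "\<lambda>b. transpose_mat T *\<^sub>v map_vec real_of_int b"
  let ?B = "mat_of_rows n bs" and ?B' = "mat_of_rows n (map ?f bs)"
  have Tt: "transpose_mat T \<in> carrier_mat n n" using T by simp
  have nth: "bs ! i \<in> carrier_vec n" if "i < ?l" for i using bs that by auto
  have f: "set (map ?f bs) \<subseteq> carrier_vec n"
    using T by (auto intro!: mult_mat_vec_carrier[OF Tt] simp: subsetD[OF bs])
  let ?R = "map_mat real_of_int (transpose_mat ?B)"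
  have R: "?R \<in> carrier_mat n ?l" by simp
  have B': "transpose_mat ?B' = transpose_mat T * ?R"
  proof (rule eq_matI)
    fix i j assume "i < dim_row (transpose_mat T * ?R)" "j < dim_col (transpose_mat T * ?R)"
    then have i: "i < n" and j: "j < ?l" using T by auto
    have "col ?R j = map_vec real_of_int (bs ! j)"
      using j nth[OF j] by (auto simp: mat_of_rows_index)
    then show "transpose_mat ?B' $$ (i, j) = (transpose_mat T * ?R) $$ (i, j)"
      using i j T by (simp add: mat_of_rows_index)
  qed (use T in auto)
  have eq: "?f (transpose_mat ?B *\<^sub>v map_vec of_int y) = transpose_mat ?B' *\<^sub>v map_vec of_int y"
    if y: "y \<in> carrier_vec ?l" for y :: "int vec"
  proof -
    have y_id: "map_vec of_int y = y" by (intro eq_vecI) auto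
    have y': "map_vec real_of_int y \<in> carrier_vec ?l" using y by simp
    have "map_vec real_of_int (transpose_mat ?B *\<^sub>v y) = ?R *\<^sub>v map_vec of_int y"
      by (rule of_int_hom.mult_mat_vec_hom[of _ n ?l]) (use y in auto)
    then show ?thesis unfolding B' assoc_mult_mat_vec[OF Tt R y'] y_id by simp
  qed
  have "vec_module.lattice_of n bs =
      (\<lambda>y. transpose_mat ?B *\<^sub>v map_vec of_int y) ` carrier_vec ?l"
    by (rule lattice_of_eq_image[OF bs])
  moreover have "vec_module.lattice_of n (map ?f bs) =
      (\<lambda>y. transpose_mat ?B' *\<^sub>v map_vec of_int y) ` carrier_vec ?l"
    using lattice_of_eq_image[OF f] by simp
  ultimately show ?thesis
    unfolding lattice_transform_def using eq by (simp add: image_image)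
qed

text \<open>The Gram matrix of the transformed basis is the lower right block of
  \<open>M M^T\<close> with \<open>M = U T\<close>. Jacobi's identity trades it for the leading
  block \<open>Q Q^T\<close> of the inverse, and \<open>Y = H Q\<close> relates the latter to
  \<open>Y Y^T\<close> up to the factor \<open>(det H)^2\<close>. Writing \<open>H\<close> as
  \<open>C X\<close> keeps the unimodular matrices out of the conclusion.\<close>

lemma lattice_det_transform_perp:
  fixes bs :: "int vec list" and T T' :: "real mat"
  assumes li: "lin_indpt_list n bs" and kn: "length bs \<le> n"
    and T: "T \<in> carrier_mat n n" and T': "T' \<in> carrier_mat n n"
    and TT': "T * T' = 1\<^sub>m n" "T' * T = 1\<^sub>m n"
  defines "k \<equiv> length bs"
  defines "Y \<equiv> map_mat real_of_int (mat_of_rows n bs) * transpose_mat T'"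
    and "\<Lambda> \<equiv> lattice_transform T (lattice_perp n (vec_module.lattice_of n bs))"
  obtains X where "X \<in> carrier_mat n k" "det (mat_of_rows n bs * X) \<noteq> 0"
    "lattice_of_dim n (n - k) \<Lambda>"
    "lattice_det n \<Lambda> =
      sqrt ((det T)\<^sup>2 * det (Y * transpose_mat Y) / (real_of_int (det (mat_of_rows n bs * X)))\<^sup>2)"
proof -
  let ?C = "mat_of_rows n bs"
  have C: "?C \<in> carrier_mat k n" by (simp add: k_def)
  obtain U V H X where U: "U \<in> carrier_mat n n" and V: "V \<in> carrier_mat n n"
    and UV: "U * V = 1\<^sub>m n" "V * U = 1\<^sub>m n"
    and H: "H \<in> carrier_mat k k" and X: "X \<in> carrier_mat n k"
    and CH: "?C = H * mat k n (\<lambda>(i, j). V $$ (j, i))" and HX: "H = ?C * X" and detH: "det H \<noteq> 0"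
    and lat: "lattice_perp n (vec_module.lattice_of n bs) =
      vec_module.lattice_of n (map (\<lambda>i. row U (i + k)) [0..<n - k])"
    using lattice_perp_unimodular_basis[OF li kn] unfolding k_def by blast
  let ?r = "map_mat real_of_int"
  have Ur: "?r U \<in> carrier_mat n n" and Vr: "?r V \<in> carrier_mat n n" and Hr: "?r H \<in> carrier_mat k k"
    using U V H by auto
  have UVr: "?r U * ?r V = 1\<^sub>m n" "?r V * ?r U = 1\<^sub>m n"
    using of_int_hom.mat_hom_mult[OF U V] of_int_hom.mat_hom_mult[OF V U] UV
    by (metis of_int_hom.mat_hom_one)+
  define M where "M = ?r U * T"
  define W where "W = T' * ?r V"
  have M: "M \<in> carrier_mat n n" and W: "W \<in> carrier_mat n n"
    using Ur Vr T T' by (auto simp: M_def W_def)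
  have Mt: "transpose_mat M \<in> carrier_mat n n" and Wt: "transpose_mat W \<in> carrier_mat n n"
    using M W by auto
  have MW: "M * W = 1\<^sub>m n" "W * M = 1\<^sub>m n"
    using mult_mat_inverse_pairs[OF Ur T T' Vr] mult_mat_inverse_pairs[OF T' Vr Ur T] UVr TT'
    by (auto simp: M_def W_def)
  have MWt: "transpose_mat M * transpose_mat W = 1\<^sub>m n"
    using transpose_mult[OF W M] MW by simp
  let ?G = "M * transpose_mat M" and ?K = "transpose_mat W * W"
  have G: "?G \<in> carrier_mat n n" and K: "?K \<in> carrier_mat n n" using M W by auto
  have GK: "?G * ?K = 1\<^sub>m n" by (rule mult_mat_inverse_pairs[OF M Mt Wt W MW(1) MWt])
  \<comment> \<open>The determinant of \<open>U\<close> is 1 or -1 and disappears on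
    squaring.\<close>
  have detM: "(det M)\<^sup>2 = (det T)\<^sup>2"
  proof -
    have "det U * det V = 1" using det_mult[OF U V] UV by simp
    then have "(det U)\<^sup>2 = 1" using zmult_eq_1_iff[of "det U" "det V"] by auto
    then have "(real_of_int (det U))\<^sup>2 = 1" by (metis of_int_1 of_int_power)
    then show ?thesis
      unfolding M_def det_mult[OF Ur T] of_int_hom.hom_det by (simp add: power_mult_distrib)
  qed
  have detM0: "det M \<noteq> 0" using det_mult[OF M W] MW by auto
  let ?bs = "map (\<lambda>i. row M (i + k)) [0..<n - k]"
  have "transpose_mat T *\<^sub>v map_vec real_of_int (row U i) = row M i" if i: "i < n" for i
  proof (rule eq_vecI)
    fix j assume "j < dim_vec (row M i)"
    then have j: "j < n" using M by simp
    have "(transpose_mat T *\<^sub>v map_vec real_of_int (row U i)) $ j =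
        (\<Sum>r<n. T $$ (r, j) * real_of_int (U $$ (i, r)))"
      using index_mult_mat_vec_sum[of "transpose_mat T" n n "map_vec real_of_int (row U i)" j] T U i j by simp
    also have "\<dots> = M $$ (i, j)"
      unfolding M_def index_mult_mat_sum[OF Ur T i j] using U i
      by (intro sum.cong) auto
    finally show "(transpose_mat T *\<^sub>v map_vec real_of_int (row U i)) $ j = row M i $ j"
      using M i j by simp
  qed (use T M in auto)
  then have map_eq: "map (\<lambda>b. transpose_mat T *\<^sub>v map_vec real_of_int b)
      (map (\<lambda>i. row U (i + k)) [0..<n - k]) = ?bs"
    by auto
  have "\<Lambda> = vec_module.lattice_of n ?bs"
    unfolding \<Lambda>_def lat map_eq[symmetric]
    by (rule lattice_transform_lattice_of[OF _ T]) (use U in auto)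
  then have basis: "lattice_basis n ?bs \<Lambda>"
    unfolding lattice_basis_def using lin_indpt_list_rows[OF M detM0] by simp
  then have dim: "lattice_of_dim n (n - k) \<Lambda>"
    unfolding lattice_of_dim_def by (intro exI[of _ ?bs]) simp
  have "mat_of_rows n ?bs * transpose_mat (mat_of_rows n ?bs) =
      mat (n - k) (n - k) (\<lambda>(i, j). ?G $$ (i + k, j + k))"
    using M by (intro eq_matI) auto
  then have ld: "lattice_det n \<Lambda> = sqrt (det ?G * det (mat k k (\<lambda>(i, j). ?K $$ (i, j))))"
    using lattice_det_eq[OF basis] det_complementary_block[OF G K GK] kn by (simp add: k_def)
  have detG: "det ?G = (det T)\<^sup>2"
    using det_mult[OF M Mt] det_transpose[OF M] detM by (simp add: power2_eq_square)
  \<comment> \<open>The rows of \<open>Q\<close> are the first \<open>k\<close> columns of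
    \<open>W\<close>, the inverse of \<open>M\<close>; their Gram matrix is the leading block of
    \<open>?K\<close>.\<close>
  define Q where "Q = mat k n (\<lambda>(i, j). W $$ (j, i))"
  have Q: "Q \<in> carrier_mat k n" and Qt: "transpose_mat Q \<in> carrier_mat n k" by (auto simp: Q_def)
  have QQ: "mat k k (\<lambda>(i, j). ?K $$ (i, j)) = Q * transpose_mat Q"
  proof (rule eq_matI)
    fix i j assume "i < dim_row (Q * transpose_mat Q)" "j < dim_col (Q * transpose_mat Q)"
    then have i: "i < k" and j: "j < k" using Q by auto
    have "row Q i = col W i" if "i < k" for i
      using that W kn by (auto simp: Q_def k_def)
    then show "mat k k (\<lambda>(i, j). ?K $$ (i, j)) $$ (i, j) = (Q * transpose_mat Q) $$ (i, j)"
      using i j W Q kn by (simp add: k_def)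
  qed (use Q in auto)
  have YQ: "Y = ?r H * Q"
  proof -
    let ?V = "mat k n (\<lambda>(i, j). V $$ (j, i))"
    have Vc: "?V \<in> carrier_mat k n" and Vrc: "?r ?V \<in> carrier_mat k n"
      and Tt: "transpose_mat T' \<in> carrier_mat n n" using T' by auto
    have "?r ?V * transpose_mat T' = Q"
    proof (rule eq_matI)
      fix i j assume "i < dim_row Q" "j < dim_col Q"
      then have i: "i < k" and j: "j < n" using Q by auto
      then have i': "i < n" using kn by (simp add: k_def)
      show "(?r ?V * transpose_mat T') $$ (i, j) = Q $$ (i, j)"
        unfolding index_mult_mat_sum[OF Vrc Tt i j] Q_def
        using i j i' T' V index_mult_mat_sum[OF T' Vr j i'] by (simp add: W_def mult.commute)
    qed (use T' Q in auto)
    moreover have "?r ?C = ?r H * ?r ?V"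
      unfolding CH by (rule of_int_hom.mat_hom_mult[OF H Vc])
    ultimately show ?thesis
      unfolding Y_def using assoc_mult_mat[OF Hr Vrc Tt] by simp
  qed
  have "Y * transpose_mat Y = ?r H * (Q * transpose_mat Q) * transpose_mat (?r H)"
  proof -
    have Ht: "transpose_mat (?r H) \<in> carrier_mat k k" using Hr by simp
    show ?thesis
      unfolding YQ transpose_mult[OF Hr Q] assoc_mult_mat[OF Hr Q mult_carrier_mat[OF Qt Ht]]
        assoc_mult_mat[OF Hr mult_carrier_mat[OF Q Qt] Ht] assoc_mult_mat[OF Q Qt Ht] ..
  qed
  then have "det (Y * transpose_mat Y) = (real_of_int (det H))\<^sup>2 * det (Q * transpose_mat Q)"
    using det_mult[OF mult_carrier_mat[OF Hr mult_carrier_mat[OF Q Qt]], of "transpose_mat (?r H)"]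
      det_mult[OF Hr mult_carrier_mat[OF Q Qt]] det_transpose[OF Hr] Hr
    by (simp add: power2_eq_square of_int_hom.hom_det)
  then have "det (Q * transpose_mat Q) = det (Y * transpose_mat Y) / (real_of_int (det H))\<^sup>2"
    using detH by simp
  then have "lattice_det n \<Lambda> = sqrt ((det T)\<^sup>2 * det (Y * transpose_mat Y) / (real_of_int (det H))\<^sup>2)"
    unfolding ld detG QQ by simp
  then show thesis using that X detH dim unfolding HX by blast
qed

subsection \<open>The determinant bound\<close>

lemma det_mat_diag: "det (mat_diag n f) = (\<Prod>i<n. f i)"
proof -
  have "det (mat_diag n f) = prod_list (diag_mat (mat_diag n f))"
    by (rule det_upper_triangular[of _ n]) (auto simp: mat_diag_def)
  then show ?thesis by (simp add: prod_list_diag_prod mat_diag_def atLeast0LessThan)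
qed

text \<open>A vector of dimension \<open>d + 1\<close> has norm exponent \<open>-d/2\<close>; with
  base \<open>1/s\<close>, squaring turns this factor into \<open>s^d\<close>. The remaining sum is
  the squared length of the vector scaled by the inverse of \<open>S\<close>.\<close>

lemma norm2_inverse_square:
  assumes s: "s > 0" and x: "x \<in> carrier_vec (d + 1)"
  shows "(norm2 (inverse s) x)\<^sup>2 = s powr real d * (\<Sum>i<d + 1. (x $ i * inverse s ^ i)\<^sup>2)"
proof -
  have "(inverse s powr (- real d / 2))\<^sup>2 = s powr real d"
    using s by (simp add: powr_def ln_inverse power2_eq_square flip: exp_add)
  moreover have "0 \<le> (\<Sum>i<d + 1. (x $ i * inverse s ^ i)\<^sup>2)" by (intro sum_nonneg) simp
  ultimately show ?thesis
    using x unfolding norm2_def by (simp add: power_mult_distrib)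
qed

lemma norm2_nonneg: "0 \<le> norm2 t x"
  unfolding norm2_def by (simp add: sum_nonneg)

theorem theorem3p4:
  fixes N d k :: nat and m :: int and c :: "nat \<Rightarrow> int vec" and L :: "int vec set"
    and s :: real and S :: "real mat"
  assumes "N > 0" and "1 \<le> k" and "k \<le> d"
    and "\<And>i. i \<in> {1..k} \<Longrightarrow> geometric_progression N m (d + 1) (c i)"
    and "lin_indpt_list (d + 1) (map c [1..<k + 1])"
    and "gcd (c 1 $ 0) (int N) = 1"
    and "lattice_basis (d + 1) (map c [1..<k + 1]) L"
    and "s > 0"
    and "S = mat_diag (d + 1) (\<lambda>i. s ^ i)"
  shows "lattice_of_dim (d + 1) (d - k + 1) (lattice_transform S (lattice_perp (d + 1) L)) \<and>
    lattice_det (d + 1) (lattice_transform S (lattice_perp (d + 1) L))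
      \<le> s powr (real d * (real d - real k + 1) / 2) * real N powi (1 - int k)
        * (\<Prod>i = 1..k. norm2 (inverse s) (map_vec real_of_int (c i)))"
proof -
  let ?n = "d + 1" and ?bs = "map c [1..<k + 1]"
  define A where "A = mat_of_rows ?n ?bs"
  have s: "s > 0" by fact
  have c: "c i \<in> carrier_vec ?n" if "i \<in> {1..k}" for i
    using assms(4)[OF that] by (simp add: geometric_progression_def)
  have L: "L = vec_module.lattice_of ?n ?bs" using assms(7) by (simp add: lattice_basis_def)
  have len: "length ?bs = k" by simp
  have A: "A \<in> carrier_mat k ?n" unfolding A_def using len by (metis mat_of_rows_carrier(1))
  have A_index: "A $$ (i, j) = c (i + 1) $ j" if "i < k" "j < ?n" for i j
    using that by (simp add: A_def mat_of_rows_index del: upt_Suc)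
  define T where "T = mat_diag ?n (\<lambda>i. inverse s ^ i)"
  have S: "S \<in> carrier_mat ?n ?n" and T: "T \<in> carrier_mat ?n ?n" by (simp_all add: assms(9) T_def)
  have ST: "S * T = 1\<^sub>m ?n" "T * S = 1\<^sub>m ?n"
    using s by (simp_all add: assms(9) T_def power_inverse flip: mat_diag_one)
  let ?\<Lambda> = "lattice_transform S (lattice_perp ?n L)"
  define Y where "Y = map_mat real_of_int A * transpose_mat T"
  obtain X where X: "X \<in> carrier_mat ?n k" and h0: "det (A * X) \<noteq> 0"
    and dim: "lattice_of_dim ?n (?n - k) ?\<Lambda>"
    and det: "lattice_det ?n ?\<Lambda> =
      sqrt ((det S)\<^sup>2 * det (Y * transpose_mat Y) / (real_of_int (det (A * X)))\<^sup>2)"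
    using lattice_det_transform_perp[OF assms(5) _ S T ST] assms(3) unfolding len L Y_def A_def by auto
  define h where "h = det (A * X)"

  \<comment> \<open>The gcd hypothesis provides an inverse \<open>e\<close> of the first entry of
    \<open>c 1\<close>. Progressions with a common ratio are determined modulo \<open>N\<close> by
    their first entries, so \<open>c (i + 1)\<close> is \<open>a i\<close> times \<open>c 1\<close>.
    The shift arises because rows of \<open>A\<close> are counted from 0 and the progressions from
    1.\<close>
  obtain e where e: "[c 1 $ 0 * e = 1] (mod int N)"
    using assms(6) cong_solve_coprime_int[of "c 1 $ 0" "int N"] by (auto simp: coprime_iff_gcd_eq_1)
  define a where "a i = c (i + 1) $ 0 * e" for i
  have proportional: "int N dvd c (i + 1) $ j - a i * c 1 $ j" if i: "i < k" and j: "j < ?n" for i j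
  proof -
    have "[c (i + 1) $ j = c (i + 1) $ 0 * m ^ j] (mod int N)" "[c 1 $ j = c 1 $ 0 * m ^ j] (mod int N)"
      using assms(4)[of "i + 1"] assms(4)[of 1] i j assms(2) by (auto simp: geometric_progression_def)
    note 1 = this
    have "[a i * c 1 $ j = a i * (c 1 $ 0 * m ^ j)] (mod int N)" using 1(2) by (rule cong_scalar_left)
    also have "a i * (c 1 $ 0 * m ^ j) = (c 1 $ 0 * e) * (c (i + 1) $ 0 * m ^ j)" by (simp add: a_def)
    also have "[\<dots> = 1 * (c (i + 1) $ 0 * m ^ j)] (mod int N)" using e by (rule cong_scalar_right)
    finally have "[c (i + 1) $ j = a i * c 1 $ j] (mod int N)" using 1(1) by (simp add: cong_def)
    then show ?thesis by (simp add: cong_iff_dvd_diff)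
  qed
  \<comment> \<open>Row relations modulo \<open>N\<close> survive right multiplication by
    \<open>X\<close>. Writing the size as \<open>Suc (k - 1)\<close> gives one factor
    \<open>N\<close> for every row but the first.\<close>
  have "int N ^ (k - 1) dvd h"
    unfolding h_def
  proof (rule power_dvd_det_of_proportional_rows[of _ _ _ a])
    show "A * X \<in> carrier_mat (Suc (k - 1)) (Suc (k - 1))" using A X assms(2) by simp
    fix i j assume "i < Suc (k - 1)" "j < Suc (k - 1)"
    then have i: "i < k" and j: "j < k" using assms(2) by auto
    have k0: "0 < k" using assms(2) by simp
    have "(A * X) $$ (i, j) - a i * (A * X) $$ (0, j) =
        (\<Sum>r<?n. (c (i + 1) $ r - a i * c 1 $ r) * X $$ (r, j))"
      unfolding index_mult_mat_sum[OF A X i j] index_mult_mat_sum[OF A X k0 j]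
        sum_distrib_left sum_subtractf[symmetric]
      using i k0 by (intro sum.cong) (auto simp: A_index algebra_simps)
    also have "int N dvd \<dots>" using proportional[OF i] by (intro dvd_sum) auto
    finally show "int N dvd (A * X) $$ (i, j) - a i * (A * X) $$ (0, j)" .
  qed
  \<comment> \<open>A nonzero multiple is at least as large in absolute value; this is the source of
    the power of \<open>N\<close> in the bound.\<close>
  then have "int N ^ (k - 1) \<le> \<bar>h\<bar>"
    using h0 by (intro zdvd_imp_le) (auto simp: h_def)
  then have "real_of_int (int N ^ (k - 1)) \<le> real_of_int \<bar>h\<bar>" by (simp only: of_int_le_iff)
  then have Nh: "real N ^ (k - 1) \<le> \<bar>real_of_int h\<bar>" by simp

  \<comment> \<open>The squared length of row \<open>i - 1\<close> of \<open>Y\<close>, which is the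
    squared weighted norm of \<open>c i\<close> divided by \<open>s^d\<close>.\<close>
  define q where "q i = (\<Sum>j<?n. (map_vec real_of_int (c i) $ j * inverse s ^ j)\<^sup>2)" for i
  have q: "0 \<le> q i" for i unfolding q_def by (intro sum_nonneg) simp
  have Tt: "transpose_mat T \<in> carrier_mat ?n ?n" using T by simp
  have Y: "Y \<in> carrier_mat k ?n" unfolding Y_def using A Tt by (metis map_carrier_mat mult_carrier_mat)
  have T_sym: "transpose_mat T = T" by (rule eq_matI) (auto simp: T_def mat_diag_def)
  have Y_eq: "Y = mat k ?n (\<lambda>(i, j). real_of_int (A $$ (i, j)) * inverse s ^ j)"
    unfolding Y_def T_sym unfolding T_def using A by (subst mat_diag_mult_right[of _ k]) auto
  have "row Y i \<bullet> row Y i = q (i + 1)" if i: "i < k" for i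
    using i Y c[of "i + 1"] unfolding q_def scalar_prod_def
    by (auto simp: Y_eq A_index power2_eq_square atLeast0LessThan intro!: sum.cong)
  then have "det (Y * transpose_mat Y) \<le> (\<Prod>i<k. q (i + 1))"
    using gram_det_hadamard[OF Y] by simp
  also have "\<dots> = (\<Prod>i = 1..k. q i)"
    by (rule prod.reindex_bij_witness[of _ "\<lambda>i. i - 1" "\<lambda>i. i + 1"]) auto
  finally have hada: "det (Y * transpose_mat Y) \<le> (\<Prod>i = 1..k. q i)" .

  let ?R = "s powr (real d * (real d - real k + 1) / 2) * real N powi (1 - int k)
        * (\<Prod>i = 1..k. norm2 (inverse s) (map_vec real_of_int (c i)))"
  \<comment> \<open>The exponents on the diagonal add up to \<open>d (d + 1) / 2\<close>, and
    squaring removes the half.\<close>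
  have detS: "(det S)\<^sup>2 = s powr (real d * real (d + 1))"
  proof -
    have sum: "(\<Sum>i<d + 1. i) * 2 = d * (d + 1)" by (induction d) auto
    have "(det S)\<^sup>2 = s ^ (d * (d + 1))"
      unfolding assms(9) det_mat_diag power_sum[symmetric] power_mult[symmetric] sum ..
    also have "\<dots> = s powr real (d * (d + 1))" using s by (simp only: powr_realpow)
    finally show ?thesis by (simp only: of_nat_mult)
  qed
  have N: "real N powi (1 - int k) = inverse (real N ^ (k - 1))"
    using assms(2) by (simp add: power_int_def nat_diff_distrib power_inverse)
  \<comment> \<open>The bound is compared after squaring. The \<open>k\<close> norms contribute
    \<open>s^(d k)\<close>, which together with \<open>s^(d (d - k + 1))\<close> gives exactly
    \<open>s^(d (d + 1))\<close>, the square of \<open>det S\<close>.\<close>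
  have R2: "?R\<^sup>2 = s powr (real d * real (d + 1)) * (\<Prod>i = 1..k. q i) / (real N ^ (k - 1))\<^sup>2"
  proof -
    have "(\<Prod>i = 1..k. norm2 (inverse s) (map_vec real_of_int (c i)))\<^sup>2 =
        (\<Prod>i = 1..k. s powr real d * q i)"
      unfolding prod_power_distrib q_def
      using norm2_inverse_square[OF s] c by (intro prod.cong) (auto simp del: index_map_vec)
    also have "\<dots> = s powr (real d * real k) * (\<Prod>i = 1..k. q i)"
      using s by (simp add: prod.distrib powr_powr flip: powr_realpow)
    finally have P: "(\<Prod>i = 1..k. norm2 (inverse s) (map_vec real_of_int (c i)))\<^sup>2 =
      s powr (real d * real k) * (\<Prod>i = 1..k. q i)" .
    have "(s powr (real d * (real d - real k + 1) / 2))\<^sup>2 = s powr (real d * (real d - real k + 1))"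
      by (simp add: power2_eq_square flip: powr_add)
    moreover have "s powr (real d * (real d - real k + 1)) * s powr (real d * real k) =
        s powr (real d * real (d + 1))"
      by (simp add: algebra_simps flip: powr_add)
    ultimately show ?thesis
      unfolding power_mult_distrib P N by (simp add: field_simps power_inverse)
  qed
  have R0: "0 \<le> ?R" by (intro mult_nonneg_nonneg prod_nonneg) (auto simp: norm2_nonneg)
  \<comment> \<open>Hadamard's inequality bounds the numerator from above and the divisibility by
    the power of \<open>N\<close> bounds the denominator from below; \<open>R0\<close> then allows
    taking square roots.\<close>
  have "(det S)\<^sup>2 * det (Y * transpose_mat Y) / (real_of_int h)\<^sup>2 \<le> ?R\<^sup>2"
    unfolding R2 detS
  proof (rule frac_le)
    show "(real N ^ (k - 1))\<^sup>2 \<le> (real_of_int h)\<^sup>2"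
      using Nh by (metis abs_le_square_iff abs_of_nat of_nat_power)
    show "0 \<le> s powr (real d * real (d + 1)) * (\<Prod>i = 1..k. q i)"
      by (intro mult_nonneg_nonneg prod_nonneg) (auto simp: q)
  qed (use hada assms(1) in \<open>auto intro!: mult_left_mono\<close>)
  then have "lattice_det ?n ?\<Lambda> \<le> ?R"
    unfolding det h_def using R0 by (intro real_le_lsqrt) auto
  moreover have "d - k + 1 = ?n - k" using assms(3) by simp
  ultimately show ?thesis using dim by simp
qed

end
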